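(* Let $T$ be a tree of order $n \geq 2$ with $p$ pendant vertices (with the convention that $p=1$ when $n=2$). Let $K$ be a field, let $S=K[V(T)]$ be the polynomial ring over $K$ whose variables are the vertices of $T$, and let $I=I(T)\subset S$ be the edge ideal of $T$. Then $$\operatorname{reg}(S/I) \leq \min \left\{n-p , \left\lfloor \frac{2n-p}{3} \right\rfloor\right\}.$$
   Context: All graphs are finite and simple. A tree is a connected acyclic graph; its order is its number of vertices. A pendant vertex is a vertex of degree one. Convention: the tree with two vertices is regarded as the star $\mathcal{S}_1$ consisting of one central vertex and one pendant vertex, so $p=1$ for it; for $n\ge 3$, $p$ is the number of vertices of degree one. For a graph $G$ with vertex set $V(G)=\{x_1,\dots,x_n\}$ and edge set $E(G)$, the edge ideal is the squarefree monomial ideal $I(G)=(x_ix_j : \{x_i,x_j\}\in E(G))$ of $K[V(G)]=K[x_1,\dots,x_n]$, which carries the standard grading. For a finitely generated graded module $M$ over a standard graded polynomial ring, with graded Betti numbers $\beta_{i,j}(M)$ (the number of copies of $S(-j)$ in homological degree $i$ of the minimal graded free resolution), the Castelnuovo-Mumford regularity is $\operatorname{reg}(M)=\max\{j-i : \beta_{i,j}(M)\neq 0\}$. *)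

theory Defs
  imports Complex_Main "HOL-Library.Cardinality" "HOL-Library.Poly_Mapping" "HOL-Algebra.QuotRing" "HOL-Algebra.Module"
    "Jordan_Normal_Form.Matrix_Kernel"
begin

section \<open>Trees\<close>

text \<open>A graph has a finite type as its vertex set and is given by its set of edges.\<close>

definition simple_graph :: "'v::finite set set \<Rightarrow> bool" where
  "simple_graph E \<longleftrightarrow> (\<forall>e\<in>E. card e = 2)"

definition connected_graph :: "'v::finite set set \<Rightarrow> bool" where
  "connected_graph E \<longleftrightarrow> (\<forall>u v. (u, v) \<in> {(x, y). {x, y} \<in> E}\<^sup>*)"

definition graph_cycle :: "'v::finite set set \<Rightarrow> 'v list \<Rightarrow> bool" where
  "graph_cycle E vs \<longleftrightarrow> length vs \<ge> 3 \<and> distinct vs \<and>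
     (\<forall>i<length vs. {vs ! i, vs ! (Suc i mod length vs)} \<in> E)"

definition is_tree :: "'v::finite set set \<Rightarrow> bool" where
  "is_tree E \<longleftrightarrow> simple_graph E \<and> connected_graph E \<and> (\<nexists>vs. graph_cycle E vs)"

definition vertex_degree :: "'v::finite set set \<Rightarrow> 'v \<Rightarrow> nat" where
  "vertex_degree E v = card {e \<in> E. v \<in> e}"

text \<open>The tree on two vertices is regarded as a star with one centre and one pendant vertex.\<close>

definition num_pendant :: "'v::finite set set \<Rightarrow> nat" where
  "num_pendant E = (if CARD('v) = 2 then 1 else card {v. vertex_degree E v = 1})"


section \<open>Polynomial rings and edge ideals\<close>

text \<open>The polynomial ring over \<open>'k\<close> whose variables are the elements of \<open>'v\<close>: a polynomial
  maps exponent vectors to coefficients, with convolution as multiplication.\<close>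

type_synonym ('v, 'k) mpoly = "('v \<Rightarrow>\<^sub>0 nat) \<Rightarrow>\<^sub>0 'k"

definition mvar :: "'v \<Rightarrow> ('v, 'k::field) mpoly" where
  "mvar v = Poly_Mapping.single (Poly_Mapping.single v 1) 1"

definition monom_degree :: "('v \<Rightarrow>\<^sub>0 nat) \<Rightarrow> nat" where
  "monom_degree m = (\<Sum>v\<in>Poly_Mapping.keys m. Poly_Mapping.lookup m v)"

text \<open>The homogeneous component of degree \<open>d\<close> in the standard grading; it contains 0 and is
  \<open>{0}\<close> for negative \<open>d\<close>.\<close>

definition homogeneous_part :: "int \<Rightarrow> ('v, 'k::field) mpoly set" where
  "homogeneous_part d = {f. \<forall>m\<in>Poly_Mapping.keys f. int (monom_degree m) = d}"

definition irrelevant_ideal :: "('v, 'k::field) mpoly set" where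
  "irrelevant_ideal = Idl\<^bsub>class_ring\<^esub> (range mvar)"

definition edge_ideal :: "'v set set \<Rightarrow> ('v, 'k::field) mpoly set" where
  "edge_ideal E = Idl\<^bsub>class_ring\<^esub> {mvar x * mvar y | x y. {x, y} \<in> E}"


section \<open>Graded modules and minimal graded free resolutions\<close>

record ('a, 'm) graded_module = "('a, 'm) module" +
  component :: "int \<Rightarrow> 'm set"

definition quotient_module ::
  "('v, 'k::field) mpoly set \<Rightarrow> (('v, 'k) mpoly, ('v, 'k) mpoly set) graded_module" where
  "quotient_module I = ring.extend (class_ring Quot I)
     \<lparr>smult = (\<lambda>f X. (I +>\<^bsub>class_ring\<^esub> f) \<otimes>\<^bsub>class_ring Quot I\<^esub> X),
      component = (\<lambda>d. (\<lambda>f. I +>\<^bsub>class_ring\<^esub> f) ` homogeneous_part d)\<rparr>"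

text \<open>The data of a complex \<open>\<dots> \<rightarrow> F\<^sub>2 \<rightarrow> F\<^sub>1 \<rightarrow> F\<^sub>0 \<rightarrow> M\<close> of finitely generated graded free modules.
  Here \<open>F\<^sub>i\<close> is the direct sum of the \<open>S(-j)\<close> with \<open>j\<close> running through the list \<open>shifts i\<close>, that is,
  its \<open>a\<close>-th basis vector has degree \<open>shifts i ! a\<close>; the matrix \<open>diff i\<close> represents the map from
  \<open>F\<^sub>i\<^sub>+\<^sub>1\<close> to \<open>F\<^sub>i\<close>, and \<open>aug\<close> lists the images in \<open>M\<close> of the basis vectors of \<open>F\<^sub>0\<close>.\<close>

record ('a, 'm) free_complex =
  shifts :: "nat \<Rightarrow> int list"
  diff :: "nat \<Rightarrow> 'a mat"
  aug :: "'m list"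

definition free_rank :: "('a, 'm) free_complex \<Rightarrow> nat \<Rightarrow> nat" where
  "free_rank F i = length (shifts F i)"

definition aug_map ::
  "('a, 'm, 'c) graded_module_scheme \<Rightarrow> ('a, 'm) free_complex \<Rightarrow> 'a vec \<Rightarrow> 'm" where
  "aug_map M F v = (\<Oplus>\<^bsub>M\<^esub>a\<in>{..<free_rank F 0}. v $ a \<odot>\<^bsub>M\<^esub> (aug F ! a))"

definition graded_free_data ::
  "(('v, 'k::field) mpoly, 'm) graded_module \<Rightarrow> (('v, 'k) mpoly, 'm) free_complex \<Rightarrow> bool" where
  "graded_free_data M F \<longleftrightarrow>
     length (aug F) = free_rank F 0 \<and>
     (\<forall>a<free_rank F 0. aug F ! a \<in> component M (shifts F 0 ! a)) \<and>
     (\<forall>i. diff F i \<in> carrier_mat (free_rank F i) (free_rank F (Suc i)) \<and>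
       (\<forall>a<free_rank F i. \<forall>b<free_rank F (Suc i).
          diff F i $$ (a, b) \<in> homogeneous_part (shifts F (Suc i) ! b - shifts F i ! a)))"

definition graded_free_resolution ::
  "(('v, 'k::field) mpoly, 'm) graded_module \<Rightarrow> (('v, 'k) mpoly, 'm) free_complex \<Rightarrow> bool" where
  "graded_free_resolution M F \<longleftrightarrow>
     graded_free_data M F \<and>
     aug_map M F ` carrier_vec (free_rank F 0) = carrier M \<and>
     {v \<in> carrier_vec (free_rank F 0). aug_map M F v = \<zero>\<^bsub>M\<^esub>} =
       (\<lambda>w. diff F 0 *\<^sub>v w) ` carrier_vec (free_rank F 1) \<and>
     (\<forall>i. mat_kernel (diff F i) =
       (\<lambda>w. diff F (Suc i) *\<^sub>v w) ` carrier_vec (free_rank F (Suc (Suc i))))"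

definition minimal_graded_free_resolution ::
  "(('v, 'k::field) mpoly, 'm) graded_module \<Rightarrow> (('v, 'k) mpoly, 'm) free_complex \<Rightarrow> bool" where
  "minimal_graded_free_resolution M F \<longleftrightarrow>
     graded_free_resolution M F \<and> (\<forall>i. elements_mat (diff F i) \<subseteq> irrelevant_ideal)"

text \<open>A finitely generated graded module has a minimal graded free resolution, and it is unique up
  to isomorphism, so the choice made here does not affect the value.\<close>

definition graded_betti ::
  "(('v, 'k::field) mpoly, 'm) graded_module \<Rightarrow> nat \<Rightarrow> int \<Rightarrow> nat" where
  "graded_betti M i j =
     count_list (shifts (SOME F. minimal_graded_free_resolution M F) i) j"

text \<open>Meaningful for nonzero finitely generated \<open>M\<close> over finitely many variables, where the set is
  finite and nonempty.\<close>

definition regularity :: "(('v, 'k::field) mpoly, 'm) graded_module \<Rightarrow> int" where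
  "regularity M = Max {j - int i | i j. graded_betti M i j \<noteq> 0}"

end

theory Submission
  imports Defs "HOL-Library.Function_Algebras"
begin

text \<open>
For the edge ideal \<open>I(G)\<close> of any finite simple graph, the regularity of \<open>S/I(G)\<close> is at most the
matching number of \<open>G\<close> (\<open>reg_le_matching_number\<close>).  In a tree, let \<open>M\<close> be a matching.  If there are
at least three vertices, no edge joins two pendant vertices, so sending each edge of \<open>M\<close> to an
endpoint that is not pendant gives \<open>|M| \<le> n - p\<close> (\<open>matching_pendant_bound\<close>).  The edges of \<open>M\<close>
are disjoint, hence \<open>2|M| \<le> n\<close>, and adding the two inequalities gives \<open>3|M| \<le> 2n - p\<close>.  With the
convention \<open>p = 1\<close> both inequalities also hold for \<open>n = 2\<close>.

The matching bound is proved by adjoining the generators of the ideal one at a time.  If \<open>x\<^sub>A\<close> is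
the squarefree monomial with support \<open>A\<close>, then the syzygies of \<open>J + (x\<^sub>A)\<close> are an extension of the
colon ideal \<open>J : x\<^sub>A\<close>, shifted by \<open>|A|\<close>, by the syzygies of \<open>J\<close>.  If \<open>J\<close> is generated by the
monomials \<open>x\<^sub>e\<close>, the colon ideal is generated by the monomials with support \<open>e - A\<close>; when \<open>A\<close> is an
edge and all \<open>e\<close> have at most two elements, only edges disjoint from \<open>A\<close> survive as quadrics.  So So the
matching number drops by one. This pays for the shift by two, since syzygies are allowed one degree
more than generators.  This induction needs generators of degree at
most two, not only quadrics, since colon ideals contain variables (and possibly \<open>1\<close>).

Bounds on the shifts of partial resolutions are organised by the predicate \<open>reg_upto\<close>, which asks
for a \<open>k\<close>-step resolution with shifts at most \<open>r + i\<close> in step \<open>i\<close>.  It is preserved by extensions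
(\<open>reg_upto_extension\<close>, the horseshoe lemma), by kernels of surjections onto free modules
(\<open>reg_upto_kernel\<close>), and therefore the syzygies satisfy it for every choice of generators of bounded
degree (\<open>reg_upto_change_gens\<close>, a form of Schanuel's lemma).  Minimal generators have bounded degree
(\<open>minimal_gens_degree\<close>).  Together these facts give two things: syzygy modules stay finitely generated,
so that a minimal resolution can be built step by step (\<open>minimal_resolution_exists\<close>), and every
minimal resolution of \<open>S/I\<close> obeys the bound (\<open>minimal_resolution_upper\<close>), in particular the one
used to define the Betti numbers.
\<close>

section \<open>Homogeneous components\<close>

definition hcomp :: "int \<Rightarrow> ('v, 'k::field) mpoly \<Rightarrow> ('v, 'k) mpoly" where
  "hcomp d f = (\<Sum>m | m \<in> Poly_Mapping.keys f \<and> int (monom_degree m) = d.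
     Poly_Mapping.single m (Poly_Mapping.lookup f m))"

lemma lookup_hcomp:
  "Poly_Mapping.lookup (hcomp d f) m =
     (if int (monom_degree m) = d then Poly_Mapping.lookup f m else 0)"
proof -
  have "Poly_Mapping.lookup (hcomp d f) m =
      (\<Sum>m' | m' \<in> Poly_Mapping.keys f \<and> int (monom_degree m') = d.
         if m' = m then Poly_Mapping.lookup f m' else 0)"
    by (simp add: hcomp_def lookup_sum lookup_single when_def cong: if_cong)
  also have "\<dots> = (if int (monom_degree m) = d then Poly_Mapping.lookup f m else 0)"
    by (subst sum.delta) (auto simp: in_keys_iff)
  finally show ?thesis .
qed

lemma hcomp_zero [simp]: "hcomp d 0 = 0"
  by (rule poly_mapping_eqI) (simp add: lookup_hcomp)

lemma hcomp_add: "hcomp d (f + g) = hcomp d f + hcomp d g"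
  by (rule poly_mapping_eqI) (simp add: lookup_hcomp lookup_add)

lemma hcomp_sum: "hcomp d (sum f A) = (\<Sum>a\<in>A. hcomp d (f a))"
  by (induction A rule: infinite_finite_induct) (auto simp: hcomp_add)

lemma homogeneous_iff: "f \<in> homogeneous_part d \<longleftrightarrow> hcomp d f = f"
proof
  assume f: "f \<in> homogeneous_part d"
  show "hcomp d f = f"
  proof (rule poly_mapping_eqI)
    fix m
    show "Poly_Mapping.lookup (hcomp d f) m = Poly_Mapping.lookup f m"
      using f by (cases "m \<in> Poly_Mapping.keys f")
        (auto simp: lookup_hcomp homogeneous_part_def in_keys_iff)
  qed
next
  assume "hcomp d f = f"
  then show "f \<in> homogeneous_part d"
    unfolding homogeneous_part_def
    by (auto simp: in_keys_iff) (metis lookup_hcomp)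
qed

lemma hcomp_homogeneous [simp]: "hcomp d f \<in> homogeneous_part d"
  by (auto simp: homogeneous_part_def in_keys_iff lookup_hcomp split: if_splits)

lemma hcomp_other: "f \<in> homogeneous_part d \<Longrightarrow> e \<noteq> d \<Longrightarrow> hcomp e f = 0"
  by (rule poly_mapping_eqI) (auto simp: lookup_hcomp homogeneous_part_def in_keys_iff)

lemma zero_homogeneous [simp]: "0 \<in> homogeneous_part d"
  by (simp add: homogeneous_part_def)

lemma monom_degree_superset:
  "finite A \<Longrightarrow> Poly_Mapping.keys m \<subseteq> A \<Longrightarrow> monom_degree m = (\<Sum>v\<in>A. Poly_Mapping.lookup m v)"
  unfolding monom_degree_def
  by (rule sum.mono_neutral_left) (auto simp: in_keys_iff)

lemma monom_degree_add: "monom_degree (a + b) = monom_degree a + monom_degree b"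
proof -
  let ?A = "Poly_Mapping.keys a \<union> Poly_Mapping.keys b"
  have "monom_degree (a + b) = (\<Sum>v\<in>?A. Poly_Mapping.lookup (a + b) v)"
    using keys_add[of a b] by (intro monom_degree_superset) auto
  also have "\<dots> = (\<Sum>v\<in>?A. Poly_Mapping.lookup a v) + (\<Sum>v\<in>?A. Poly_Mapping.lookup b v)"
    by (simp add: lookup_add sum.distrib)
  also have "\<dots> = monom_degree a + monom_degree b"
    by (simp add: monom_degree_superset[of ?A a] monom_degree_superset[of ?A b])
  finally show ?thesis .
qed

lemma monom_degree_zero [simp]: "monom_degree 0 = 0"
  by (simp add: monom_degree_def)

lemma monom_degree_eq_0_iff: "monom_degree m = 0 \<longleftrightarrow> m = 0"
  by (auto simp: monom_degree_def in_keys_iff intro!: poly_mapping_eqI)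

lemma mult_homogeneous:
  assumes "f \<in> homogeneous_part d" "g \<in> homogeneous_part e"
  shows "f * g \<in> homogeneous_part (d + e)"
  unfolding homogeneous_part_def mem_Collect_eq
proof
  fix m assume "m \<in> Poly_Mapping.keys (f * g)"
  then obtain a b where "m = a + b" "a \<in> Poly_Mapping.keys f" "b \<in> Poly_Mapping.keys g"
    using keys_mult[of f g] by auto
  then show "int (monom_degree m) = d + e"
    using assms by (auto simp: homogeneous_part_def monom_degree_add)
qed

text \<open>The terms of \<open>f\<close> outside degree \<open>d\<close> contribute nothing in degree \<open>d + e\<close>, because degrees of
monomials add.\<close>

lemma hcomp_mult:
  assumes g: "g \<in> homogeneous_part e"
  shows "hcomp (d + e) (f * g) = hcomp d f * g"
proof -
  let ?f = "f - hcomp d f"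
  have "hcomp (d + e) (?f * g) = 0"
  proof (rule poly_mapping_eqI)
    fix m
    have "m \<notin> Poly_Mapping.keys (?f * g)" if m: "int (monom_degree m) = d + e"
    proof
      assume "m \<in> Poly_Mapping.keys (?f * g)"
      then obtain a b where ab: "m = a + b" "a \<in> Poly_Mapping.keys ?f" "b \<in> Poly_Mapping.keys g"
        using keys_mult[of ?f g] by auto
      have "int (monom_degree b) = e"
        using ab(3) g by (auto simp: homogeneous_part_def)
      then have "int (monom_degree a) = d"
        using m ab(1) by (simp add: monom_degree_add)
      then show False
        using ab(2) by (simp add: in_keys_iff lookup_minus lookup_hcomp)
    qed
    then show "Poly_Mapping.lookup (hcomp (d + e) (?f * g)) m = Poly_Mapping.lookup 0 m"
      by (simp add: lookup_hcomp in_keys_iff)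
  qed
  moreover have "f * g = hcomp d f * g + ?f * g"
    by (simp add: algebra_simps)
  ultimately have "hcomp (d + e) (f * g) = hcomp (d + e) (hcomp d f * g)"
    by (simp add: hcomp_add)
  also have "\<dots> = hcomp d f * g"
    using mult_homogeneous[OF hcomp_homogeneous g] by (simp add: homogeneous_iff)
  finally show ?thesis .
qed

abbreviation const_coeff :: "('v, 'k::field) mpoly \<Rightarrow> 'k" where
  "const_coeff f \<equiv> Poly_Mapping.lookup f 0"

lemma const_coeff_mult_zero:
  assumes "const_coeff f = 0"
  shows "const_coeff (f * g) = 0"
proof (rule ccontr)
  assume "const_coeff (f * g) \<noteq> 0"
  then obtain a b where ab: "0 = a + b" "a \<in> Poly_Mapping.keys f" "b \<in> Poly_Mapping.keys g"
    using keys_mult[of f g] by (auto simp: in_keys_iff)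
  have "monom_degree a = 0"
    using ab(1) monom_degree_add[of a b] by (metis add_is_0 monom_degree_zero)
  then show False
    using ab(2) assms by (simp add: monom_degree_eq_0_iff in_keys_iff)
qed

lemma const_coeff_homogeneous:
  "f \<in> homogeneous_part d \<Longrightarrow> d \<noteq> 0 \<Longrightarrow> const_coeff f = 0"
  using hcomp_other[of f d 0] lookup_hcomp[of 0 f 0] by simp

definition const_poly :: "'k \<Rightarrow> ('v, 'k::field) mpoly" where
  "const_poly c = Poly_Mapping.single 0 c"

lemma const_poly_mult: "const_poly a * const_poly b = const_poly (a * b)"
  by (simp add: const_poly_def mult_single)

lemma const_poly_1: "const_poly 1 = 1"
  by (simp add: const_poly_def)

lemma homogeneous_0: "f \<in> homogeneous_part 0 \<Longrightarrow> f = const_poly (const_coeff f)"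
  by (rule poly_mapping_eqI)
    (auto simp: const_poly_def lookup_single when_def homogeneous_part_def in_keys_iff
       monom_degree_eq_0_iff)

lemma homogeneous_neg: "f \<in> homogeneous_part d \<Longrightarrow> d < 0 \<Longrightarrow> f = 0"
  by (rule poly_mapping_eqI) (auto simp: homogeneous_part_def in_keys_iff)

lemma one_homogeneous [simp]: "1 \<in> homogeneous_part 0"
  by (simp add: homogeneous_part_def)


section \<open>Graded submodules of free modules\<close>

type_synonym ('v, 'k) fvec = "nat \<Rightarrow> ('v, 'k) mpoly"

text \<open>A free module with basis vectors of degrees \<open>s ! 0, s ! 1, \<dots>\<close>. Vectors are functions on all of \<open>nat\<close>
that vanish from \<open>length s\<close> on, so that modules of different ranks share one type and direct sums
correspond to appending lists of degrees.\<close>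

definition free_module :: "int list \<Rightarrow> ('v, 'k::field) fvec set" where
  "free_module s = {v. \<forall>i\<ge>length s. v i = 0}"

definition smul :: "('v, 'k::field) mpoly \<Rightarrow> ('v, 'k) fvec \<Rightarrow> ('v, 'k) fvec" where
  "smul f v = (\<lambda>i. f * v i)"

text \<open>A vector is homogeneous of degree \<open>d\<close> when its \<open>i\<close>-th coordinate has degree \<open>d - s ! i\<close>.\<close>

definition vcomp :: "int list \<Rightarrow> int \<Rightarrow> ('v, 'k::field) fvec \<Rightarrow> ('v, 'k) fvec" where
  "vcomp s d v = (\<lambda>i. hcomp (d - s ! i) (v i))"

definition hom_vec :: "int list \<Rightarrow> int \<Rightarrow> ('v, 'k::field) fvec \<Rightarrow> bool" where
  "hom_vec s d v \<longleftrightarrow> v \<in> free_module s \<and> (\<forall>i. v i \<in> homogeneous_part (d - s ! i))"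

definition graded_submodule :: "int list \<Rightarrow> ('v, 'k::field) fvec set \<Rightarrow> bool" where
  "graded_submodule s N \<longleftrightarrow> N \<subseteq> free_module s \<and> 0 \<in> N \<and> (\<forall>u\<in>N. \<forall>v\<in>N. u + v \<in> N) \<and>
     (\<forall>f. \<forall>v\<in>N. smul f v \<in> N) \<and> (\<forall>d. \<forall>v\<in>N. vcomp s d v \<in> N)"

definition lincomb :: "('v, 'k::field) fvec list \<Rightarrow> ('v, 'k) fvec \<Rightarrow> ('v, 'k) fvec" where
  "lincomb gs c = (\<lambda>i. \<Sum>a<length gs. c a * (gs ! a) i)"

text \<open>In \<open>lincomb gs c\<close> the values of \<open>c\<close> beyond the length of \<open>gs\<close> are ignored; a syzygy is required
to vanish there, so that it is an element of a free module of rank \<open>length gs\<close>.\<close>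

definition syz :: "('v, 'k::field) fvec list \<Rightarrow> ('v, 'k) fvec set" where
  "syz gs = {c. (\<forall>a\<ge>length gs. c a = 0) \<and> lincomb gs c = 0}"

definition hom_gens ::
  "int list \<Rightarrow> ('v, 'k::field) fvec set \<Rightarrow> ('v, 'k) fvec list \<Rightarrow> int list \<Rightarrow> bool" where
  "hom_gens s N gs ts \<longleftrightarrow> length gs = length ts \<and> (\<forall>a<length gs. hom_vec s (ts ! a) (gs ! a)) \<and>
     N = range (lincomb gs)"

definition basis :: "nat \<Rightarrow> ('v, 'k::field) fvec" where
  "basis b = (\<lambda>i. if i = b then 1 else 0)"

lemma smul_apply [simp]: "smul f v i = f * v i"
  by (simp add: smul_def)

lemma smul_zero [simp]: "smul f 0 = 0"
  by (auto simp: smul_def)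

lemma smul_minus_one: "smul (- 1) v = - v"
  by (auto simp: smul_def)

lemma submoduleD:
  assumes "graded_submodule s N"
  shows "u \<in> N \<Longrightarrow> u \<in> free_module s" "0 \<in> N" "u \<in> N \<Longrightarrow> v \<in> N \<Longrightarrow> u + v \<in> N"
    "u \<in> N \<Longrightarrow> smul f u \<in> N" "u \<in> N \<Longrightarrow> vcomp s d u \<in> N" "u \<in> N \<Longrightarrow> v \<in> N \<Longrightarrow> u - v \<in> N"
proof -
  show "u \<in> N \<Longrightarrow> v \<in> N \<Longrightarrow> u - v \<in> N"
    using assms smul_minus_one[of v] unfolding graded_submodule_def
    by (metis diff_conv_add_uminus)
qed (use assms in \<open>auto simp: graded_submodule_def\<close>)

lemma vcomp_hom:
  "v \<in> free_module s \<Longrightarrow> hom_vec s d (vcomp s d v)"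
  by (auto simp: hom_vec_def vcomp_def free_module_def)

lemma vcomp_id: "hom_vec s d v \<Longrightarrow> vcomp s d v = v"
  by (auto simp: hom_vec_def vcomp_def homogeneous_iff)

lemma vcomp_zero [simp]: "vcomp s d 0 = 0"
  by (auto simp: vcomp_def)

lemma vcomp_add: "vcomp s d (u + v) = vcomp s d u + vcomp s d v"
  by (auto simp: vcomp_def hcomp_add)

lemma free_module_graded: "graded_submodule s (free_module s)"
  by (auto simp: graded_submodule_def free_module_def vcomp_def)

lemma lincomb_cong:
  "(\<And>a. a < length gs \<Longrightarrow> c a = c' a) \<Longrightarrow> lincomb gs c = lincomb gs c'"
  by (auto simp: lincomb_def)

lemma lincomb_zero [simp]: "lincomb gs 0 = 0"
  by (auto simp: lincomb_def)

lemma lincomb_Nil [simp]: "lincomb [] c = 0"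
  by (auto simp: lincomb_def)

lemma lincomb_add: "lincomb gs (c + c') = lincomb gs c + lincomb gs c'"
  by (auto simp: lincomb_def algebra_simps sum.distrib)

lemma lincomb_smul: "lincomb gs (smul f c) = smul f (lincomb gs c)"
  by (auto simp: lincomb_def algebra_simps sum_distrib_left)

lemma lincomb_diff: "lincomb gs (c - c') = lincomb gs c - lincomb gs c'"
  by (auto simp: lincomb_def algebra_simps sum_subtractf)

lemma lincomb_uminus: "lincomb gs (- c) = - lincomb gs c"
  by (auto simp: lincomb_def sum_negf)

lemma lincomb_append:
  "lincomb (gs @ hs) c = lincomb gs c + lincomb hs (\<lambda>a. c (a + length gs))"
proof
  fix i
  have "(\<Sum>a<length gs + n. F a) = (\<Sum>a<length gs. F a) + (\<Sum>a<n. F (a + length gs))"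
    for n and F :: "nat \<Rightarrow> ('a, 'b) mpoly"
    by (induction n) (simp_all add: add_ac)
  from this[where n = "length hs"]
  show "lincomb (gs @ hs) c i = (lincomb gs c + lincomb hs (\<lambda>a. c (a + length gs))) i"
    by (simp add: lincomb_def nth_append)
qed

lemma lincomb_basis: "b < length gs \<Longrightarrow> lincomb gs (basis b) = gs ! b"
  by (auto simp: lincomb_def basis_def if_distrib[of "\<lambda>x. x * _"] cong: if_cong)

text \<open>Homogeneous generators turn linear combination into a graded map. This is what makes syzygy
modules graded and allows coefficients to be chosen homogeneous.\<close>

lemma lincomb_vcomp:
  assumes "length gs = length ts" "\<And>a. a < length gs \<Longrightarrow> hom_vec s (ts ! a) (gs ! a)"
  shows "vcomp s d (lincomb gs c) = lincomb gs (vcomp ts d c)"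
proof
  fix i
  have "hcomp (d - s ! i) (c a * (gs ! a) i) = hcomp (d - ts ! a) (c a) * (gs ! a) i"
    if "a < length gs" for a
    using hcomp_mult[of "(gs ! a) i" "ts ! a - s ! i" "d - ts ! a" "c a"] assms(2)[OF that]
    by (simp add: hom_vec_def)
  then show "vcomp s d (lincomb gs c) i = lincomb gs (vcomp ts d c) i"
    by (simp add: vcomp_def lincomb_def hcomp_sum)
qed

lemma syzD: "c \<in> syz gs \<Longrightarrow> lincomb gs c = 0" "c \<in> syz gs \<Longrightarrow> a \<ge> length gs \<Longrightarrow> c a = 0"
  by (auto simp: syz_def)

lemma syz_graded:
  assumes "hom_gens s N gs ts"
  shows "graded_submodule ts (syz gs)"
proof -
  have "vcomp ts d c \<in> syz gs" if "c \<in> syz gs" for c d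
  proof -
    have "lincomb gs (vcomp ts d c) = vcomp s d (lincomb gs c)"
      using assms lincomb_vcomp[of gs ts s d c] by (simp add: hom_gens_def)
    also have "\<dots> = 0"
      using that by (simp add: syzD)
    finally show ?thesis
      using that by (simp add: syz_def) (simp add: vcomp_def)
  qed
  then show ?thesis
    using assms
    by (auto simp: graded_submodule_def free_module_def hom_gens_def syz_def lincomb_add lincomb_smul)
qed

lemma lincomb_in_submodule:
  assumes "graded_submodule s N" "\<And>a. a < length gs \<Longrightarrow> gs ! a \<in> N"
  shows "lincomb gs c \<in> N"
  using assms(2)
proof (induction gs rule: rev_induct)
  case Nil
  show "lincomb [] c \<in> N" using submoduleD(2)[OF assms(1)] by simp
next
  case (snoc g gs)
  have "gs ! a \<in> N" if "a < length gs" for a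
    using snoc.prems[of a] that by (simp add: nth_append)
  moreover have "g \<in> N"
    using snoc.prems[of "length gs"] by simp
  moreover have "lincomb (gs @ [g]) c = lincomb gs c + smul (c (length gs)) g"
    by (auto simp: lincomb_append) (auto simp: lincomb_def)
  ultimately show "lincomb (gs @ [g]) c \<in> N"
    using submoduleD(3,4)[OF assms(1)] snoc.IH by metis
qed

lemma hom_gens_graded:
  assumes "hom_gens s N gs ts"
  shows "graded_submodule s N"
proof -
  have "vcomp s d (lincomb gs c) \<in> N" for c d
    using assms lincomb_vcomp[of gs ts s d c] by (auto simp: hom_gens_def)
  moreover have "lincomb gs c \<in> free_module s" for c
    using assms
    by (intro lincomb_in_submodule[OF free_module_graded]) (auto simp: hom_gens_def hom_vec_def)
  moreover have "0 \<in> N"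
    using assms lincomb_zero[of gs] by (metis hom_gens_def rangeI)
  ultimately show ?thesis
    using assms unfolding graded_submodule_def hom_gens_def
    by (auto simp flip: lincomb_add lincomb_smul)
qed

lemma hom_gensI:
  assumes "graded_submodule s N" "length gs = length ts"
    and "\<And>a. a < length gs \<Longrightarrow> hom_vec s (ts ! a) (gs ! a)"
    and "\<And>a. a < length gs \<Longrightarrow> gs ! a \<in> N"
    and "\<And>v. v \<in> N \<Longrightarrow> \<exists>c. v = lincomb gs c"
  shows "hom_gens s N gs ts"
proof -
  have "N = range (lincomb gs)"
    using assms(5) lincomb_in_submodule[OF assms(1,4)] by blast
  with assms show ?thesis by (simp add: hom_gens_def)
qed

lemma hom_gens_mem: "hom_gens s N gs ts \<Longrightarrow> a < length gs \<Longrightarrow> gs ! a \<in> N"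
  using lincomb_basis[of a gs] by (auto simp: hom_gens_def) (metis rangeI)

section \<open>Partial resolutions with bounded shifts\<close>

text \<open>There are generators of \<open>N\<close> of degree at most \<open>r\<close>, generators of their syzygies of degree at most
\<open>r + 1\<close>, and so on for \<open>k\<close> steps. Stopping after \<open>k\<close> steps makes induction possible although the
resolution may a priori be infinite.\<close>

fun reg_upto :: "nat \<Rightarrow> int \<Rightarrow> int list \<Rightarrow> ('v, 'k::field) fvec set \<Rightarrow> bool" where
  "reg_upto 0 r s N \<longleftrightarrow> True"
| "reg_upto (Suc k) r s N \<longleftrightarrow>
     (\<exists>gs ts. hom_gens s N gs ts \<and> (\<forall>t\<in>set ts. t \<le> r) \<and> reg_upto k (r + 1) ts (syz gs))"

lemma reg_uptoI:
  "hom_gens s N gs ts \<Longrightarrow> (\<And>t. t \<in> set ts \<Longrightarrow> t \<le> r) \<Longrightarrow> reg_upto k (r + 1) ts (syz gs) \<Longrightarrow>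
     reg_upto (Suc k) r s N"
  by auto

lemma reg_upto_mono: "reg_upto k r s N \<Longrightarrow> r \<le> r' \<Longrightarrow> reg_upto k r' s N"
proof (induction k arbitrary: r r' s N)
  case (Suc k)
  from Suc.prems obtain gs ts where *: "hom_gens s N gs ts" "\<forall>t\<in>set ts. t \<le> r"
    "reg_upto k (r + 1) ts (syz gs)" by auto
  have "reg_upto k (r' + 1) ts (syz gs)"
    using Suc.IH[OF *(3)] Suc.prems(2) by simp
  then show ?case
    using * Suc.prems(2) by (intro reg_uptoI[of s N gs ts]) auto
qed simp

lemma reg_upto_Suc: "reg_upto (Suc k) r s N \<Longrightarrow> reg_upto k r s N"
proof (induction k arbitrary: r s N)
  case (Suc k)
  from Suc.prems obtain gs ts where *: "hom_gens s N gs ts" "\<forall>t\<in>set ts. t \<le> r"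
    "reg_upto (Suc k) (r + 1) ts (syz gs)" unfolding reg_upto.simps(2)[of "Suc k"] by blast
  then show ?case
    using Suc.IH[OF *(3)] by (intro reg_uptoI[of s N gs ts]) auto
qed simp

lemma reg_upto_zero: "reg_upto k r s {0::('v, 'k::field) fvec}"
proof (induction k arbitrary: r s)
  case (Suc k)
  have "syz ([] :: ('v, 'k) fvec list) = {0}"
    by (auto simp: syz_def)
  moreover have "hom_gens s {0} ([] :: ('v, 'k) fvec list) []"
    by (auto simp: hom_gens_def)
  ultimately show ?case
    using reg_uptoI[of s "{0}" "[]" "[]" r k] Suc.IH[of "r + 1" "[]"] by (metis list.set(1) empty_iff)
qed simp

lemma lincomb_basis_list:
  "lincomb (map basis [0..<n]) c = (\<lambda>i. if i < n then c i else 0)"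
  by (auto simp: lincomb_def basis_def if_distrib[of "\<lambda>x. _ * x"] cong: if_cong)

lemma hom_gens_free:
  "hom_gens s (free_module s :: ('v, 'k::field) fvec set) (map basis [0..<length s]) s"
proof (rule hom_gensI[OF free_module_graded])
  show "\<exists>c. v = lincomb (map basis [0..<length s]) c" if "v \<in> free_module s" for v :: "('v, 'k) fvec"
    using that by (intro exI[of _ v]) (auto simp: lincomb_basis_list free_module_def)
qed (auto simp: hom_vec_def free_module_def basis_def)

lemma reg_upto_free:
  assumes "\<And>t. t \<in> set s \<Longrightarrow> t \<le> r"
  shows "reg_upto k r s (free_module s :: ('v, 'k::field) fvec set)"
proof (cases k)
  case (Suc k')
  have "syz (map basis [0..<length s] :: ('v, 'k) fvec list) = {0}"
    by (auto simp: syz_def lincomb_basis_list fun_eq_iff) (metis not_le)+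
  then show ?thesis
    unfolding Suc using assms hom_gens_free reg_upto_zero by (intro reg_uptoI) auto
qed simp

text \<open>The grading of the ambient free module enters only through coordinates that elements of \<open>N\<close> use.\<close>

lemma reg_upto_append:
  fixes N :: "('v, 'k::field) fvec set"
  assumes "reg_upto k r s N" "graded_submodule s N"
  shows "reg_upto k r (s @ s') N"
proof (cases k)
  case (Suc k')
  from assms obtain gs ts where *: "hom_gens s N gs ts" "\<forall>t\<in>set ts. t \<le> r"
    "reg_upto k' (r + 1) ts (syz gs)" unfolding Suc by auto
  have "hom_vec (s @ s') d v" if "hom_vec s d v" for d and v :: "('v, 'k) fvec"
    using that by (auto simp: hom_vec_def free_module_def nth_append)
  then have "hom_gens (s @ s') N gs ts"
    using *(1) by (auto simp: hom_gens_def)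
  then show ?thesis
    unfolding Suc using * by (intro reg_uptoI) auto
qed simp

definition vjoin :: "nat \<Rightarrow> ('v, 'k::field) fvec \<Rightarrow> ('v, 'k) fvec \<Rightarrow> ('v, 'k) fvec" where
  "vjoin n u v = (\<lambda>i. if i < n then u i else v (i - n))"

lemma lincomb_vjoin: "lincomb (gs @ hs) (vjoin (length gs) c d) = lincomb gs c + lincomb hs d"
proof -
  have "lincomb gs (vjoin (length gs) c d) = lincomb gs c"
    by (rule lincomb_cong) (simp add: vjoin_def)
  moreover have "lincomb hs (\<lambda>a. vjoin (length gs) c d (a + length gs)) = lincomb hs d"
    by (rule lincomb_cong) (simp add: vjoin_def)
  ultimately show ?thesis by (simp add: lincomb_append)
qed

text \<open>A homomorphism of graded modules of degree zero, with domain \<open>P\<close>; outside \<open>P\<close> the function \<open>\<theta>\<close> is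
unconstrained.\<close>

locale graded_map =
  fixes s s' :: "int list" and P :: "('v, 'k::field) fvec set"
    and \<theta> :: "('v, 'k) fvec \<Rightarrow> ('v, 'k) fvec"
  assumes P: "graded_submodule s P"
    and maps: "v \<in> P \<Longrightarrow> \<theta> v \<in> free_module s'"
    and map_add: "u \<in> P \<Longrightarrow> v \<in> P \<Longrightarrow> \<theta> (u + v) = \<theta> u + \<theta> v"
    and map_smul: "v \<in> P \<Longrightarrow> \<theta> (smul f v) = smul f (\<theta> v)"
    and map_vcomp: "v \<in> P \<Longrightarrow> \<theta> (vcomp s d v) = vcomp s' d (\<theta> v)"
begin

lemma map_zero: "\<theta> 0 = 0"
  using map_add[OF submoduleD(2)[OF P] submoduleD(2)[OF P]] by simp

lemma map_diff: "u \<in> P \<Longrightarrow> v \<in> P \<Longrightarrow> \<theta> (u - v) = \<theta> u - \<theta> v"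
  using map_add[of "u - v" v] submoduleD(6)[OF P] by (simp add: eq_diff_eq)

lemma map_lincomb:
  assumes "\<And>a. a < length gs \<Longrightarrow> gs ! a \<in> P"
  shows "\<theta> (lincomb gs c) = lincomb (map \<theta> gs) c"
  using assms
proof (induction gs rule: rev_induct)
  case Nil
  show "\<theta> (lincomb [] c) = lincomb (map \<theta> []) c" by (simp add: map_zero)
next
  case (snoc g gs)
  have gs: "gs ! a \<in> P" if "a < length gs" for a
    using snoc.prems[of a] that by (simp add: nth_append)
  have g: "g \<in> P"
    using snoc.prems[of "length gs"] by simp
  have IH: "\<theta> (lincomb gs c) = lincomb (map \<theta> gs) c"
    using snoc.IH gs by blast
  have sing: "lincomb [h] e = smul (e 0) h" for h :: "('v, 'k) fvec" and e
    by (auto simp: lincomb_def)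
  have "\<theta> (lincomb (gs @ [g]) c) = \<theta> (lincomb gs c + smul (c (length gs)) g)"
    by (simp add: lincomb_append sing)
  also have "\<dots> = \<theta> (lincomb gs c) + smul (c (length gs)) (\<theta> g)"
    using lincomb_in_submodule[OF P gs] g submoduleD(4)[OF P] by (simp add: map_add map_smul)
  also have "\<dots> = lincomb (map \<theta> (gs @ [g])) c"
    by (simp add: lincomb_append sing IH)
  finally show "\<theta> (lincomb (gs @ [g]) c) = lincomb (map \<theta> (gs @ [g])) c" .
qed

lemma kernel_graded: "graded_submodule s {v \<in> P. \<theta> v = 0}"
  using P map_zero unfolding graded_submodule_def
  by (auto simp: map_add map_smul map_vcomp)

text \<open>Any preimage can be replaced by its component of the right degree.\<close>

lemma lift_hom:
  assumes "q \<in> \<theta> ` P" "hom_vec s' d q"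
  shows "\<exists>l\<in>P. hom_vec s d l \<and> \<theta> l = q"
proof -
  from assms(1) obtain v where v: "v \<in> P" "\<theta> v = q" by auto
  then have "\<theta> (vcomp s d v) = q"
    using vcomp_id[OF assms(2)] by (simp add: map_vcomp)
  then show ?thesis
    using v submoduleD(1,5)[OF P] vcomp_hom by blast
qed

lemma lift_hom_list:
  assumes "length qs = length ts"
    and "\<And>a. a < length qs \<Longrightarrow> qs ! a \<in> \<theta> ` P"
    and "\<And>a. a < length qs \<Longrightarrow> hom_vec s' (ts ! a) (qs ! a)"
  obtains ls where "length ls = length qs" "map \<theta> ls = qs"
    "\<And>a. a < length qs \<Longrightarrow> ls ! a \<in> P \<and> hom_vec s (ts ! a) (ls ! a)"
proof -
  define L where "L a = (SOME l. l \<in> P \<and> hom_vec s (ts ! a) l \<and> \<theta> l = qs ! a)" for a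
  have L: "L a \<in> P \<and> hom_vec s (ts ! a) (L a) \<and> \<theta> (L a) = qs ! a" if "a < length qs" for a
  proof -
    have "\<exists>l. l \<in> P \<and> hom_vec s (ts ! a) l \<and> \<theta> l = qs ! a"
      using lift_hom[OF assms(2)[OF that] assms(3)[OF that]] by blast
    then show ?thesis
      unfolding L_def by (rule someI_ex)
  qed
  show ?thesis
  proof (rule that)
    show "map \<theta> (map L [0..<length qs]) = qs"
      by (rule nth_equalityI) (simp_all add: L)
  qed (simp_all add: L)
qed

end

text \<open>The projection of a submodule of \<open>F \<oplus> F'\<close> to \<open>F'\<close>, where \<open>F\<close> and \<open>F'\<close> have degree lists \<open>s\<close> and \<open>s'\<close>.\<close>

lemma graded_map_shift:
  assumes "graded_submodule (s @ s') L"
  shows "graded_map (s @ s') s' L (\<lambda>v i. v (i + length s))"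
proof
  show "(\<lambda>i. v (i + length s)) \<in> free_module s'" if "v \<in> L" for v
    using submoduleD(1)[OF assms that] by (simp add: free_module_def)
qed (use assms in \<open>auto simp: vcomp_def nth_append add.commute\<close>)

lemma shift_zero_iff:
  fixes c :: "('v, 'k::field) fvec"
  shows "(\<lambda>i. c (i + n)) = 0 \<longleftrightarrow> (\<forall>a\<ge>n. c a = 0)"
  by (auto simp: fun_eq_iff) (metis le_add_diff_inverse2)

lemma syz_append_kernel:
  "{c \<in> syz (gs @ hs). (\<lambda>i. c (i + length gs)) = 0} = syz gs"
proof -
  have "lincomb (gs @ hs) c = lincomb gs c" if "\<forall>a\<ge>length gs. c a = 0" for c
  proof -
    have "(\<lambda>i. c (i + length gs)) = 0" using that shift_zero_iff by blast
    then show ?thesis by (simp add: lincomb_append)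
  qed
  then show ?thesis
    unfolding shift_zero_iff by (auto simp: syz_def)
qed

text \<open>The horseshoe lemma. Generators of the kernel together with homogeneous lifts of generators of the
image generate \<open>P\<close>. Projecting the syzygies of this combined list to the coordinates of the lifts has
as kernel the syzygies of the first list and as image those of the second, so the induction
hypothesis applies to this projection.\<close>

proposition reg_upto_extension:
  fixes P :: "('v, 'k::field) fvec set"
  assumes "graded_map s s' P \<theta>"
    and "reg_upto k r s {v \<in> P. \<theta> v = 0}"
    and "reg_upto k r s' (\<theta> ` P)"
  shows "reg_upto k r s P"
  using assms
proof (induction k arbitrary: r s s' P \<theta>)
  case (Suc k)
  interpret graded_map s s' P \<theta> by fact
  let ?K = "{v \<in> P. \<theta> v = 0}"
  from Suc.prems(2) obtain ks tk where ks: "hom_gens s ?K ks tk" "\<forall>t\<in>set tk. t \<le> r"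
    "reg_upto k (r + 1) tk (syz ks)" unfolding reg_upto.simps by blast
  from Suc.prems(3) obtain qs tq where qs: "hom_gens s' (\<theta> ` P) qs tq" "\<forall>t\<in>set tq. t \<le> r"
    "reg_upto k (r + 1) tq (syz qs)" unfolding reg_upto.simps by blast
  have "length qs = length tq" "\<And>a. a < length qs \<Longrightarrow> qs ! a \<in> \<theta> ` P"
    "\<And>a. a < length qs \<Longrightarrow> hom_vec s' (tq ! a) (qs ! a)"
    using qs(1) hom_gens_mem[OF qs(1)] by (simp_all add: hom_gens_def)
  from lift_hom_list[OF this] obtain ls where ls: "length ls = length qs" "map \<theta> ls = qs"
    "\<And>a. a < length qs \<Longrightarrow> ls ! a \<in> P \<and> hom_vec s (tq ! a) (ls ! a)"
    by blast
  have len: "length ks = length tk" "length ls = length tq"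
    using ks(1) qs(1) ls(1) by (auto simp: hom_gens_def)
  have \<theta>ls: "\<theta> (lincomb ls c) = lincomb qs c" for c
    using map_lincomb[of ls c] ls by simp
  have lsP: "lincomb ls c \<in> P" for c
    by (rule lincomb_in_submodule[OF P]) (simp add: ls)
  have gens: "hom_gens s P (ks @ ls) (tk @ tq)"
  proof (rule hom_gensI[OF P])
    show "length (ks @ ls) = length (tk @ tq)" using len by simp
    show "hom_vec s ((tk @ tq) ! a) ((ks @ ls) ! a)" if "a < length (ks @ ls)" for a
      using that len ks(1) ls by (auto simp: nth_append hom_gens_def)
    show "(ks @ ls) ! a \<in> P" if "a < length (ks @ ls)" for a
      using that hom_gens_mem[OF ks(1)] ls by (auto simp: nth_append)
    show "\<exists>c. v = lincomb (ks @ ls) c" if v: "v \<in> P" for v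
    proof -
      obtain d where d: "\<theta> v = lincomb qs d"
        using v qs(1) unfolding hom_gens_def by blast
      have "v - lincomb ls d \<in> ?K"
        using v lsP submoduleD(6)[OF P] d \<theta>ls by (simp add: map_diff)
      then obtain c where "v - lincomb ls d = lincomb ks c"
        using ks(1) unfolding hom_gens_def by blast
      then have "v = lincomb ks c + lincomb ls d"
        by (simp add: diff_eq_eq)
      then show ?thesis
        using lincomb_vjoin[of ks ls c d] by metis
    qed
  qed
  define \<theta>' :: "('v, 'k) fvec \<Rightarrow> ('v, 'k) fvec" where "\<theta>' = (\<lambda>c i. c (i + length ks))"
  have gm: "graded_map (tk @ tq) tq (syz (ks @ ls)) \<theta>'"
    using graded_map_shift[OF syz_graded[OF gens]] len unfolding \<theta>'_def by simp
  have K': "{c \<in> syz (ks @ ls). \<theta>' c = 0} = syz ks"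
    unfolding \<theta>'_def by (rule syz_append_kernel)
  have Q': "\<theta>' ` syz (ks @ ls) = syz qs"
  proof
    show "\<theta>' ` syz (ks @ ls) \<subseteq> syz qs"
    proof
      fix d assume "d \<in> \<theta>' ` syz (ks @ ls)"
      then obtain c where c: "c \<in> syz (ks @ ls)" "d = \<theta>' c" by auto
      have "lincomb ks c + lincomb ls d = 0"
        using syzD(1)[OF c(1)] by (simp add: lincomb_append c(2) \<theta>'_def)
      then have "lincomb ls d = 0 - lincomb ks c"
        by (simp add: algebra_simps eq_neg_iff_add_eq_0)
      moreover have "lincomb ks c \<in> ?K"
        using ks(1) by (auto simp: hom_gens_def)
      ultimately have "lincomb qs d = 0"
        using \<theta>ls[of d] map_diff[OF submoduleD(2)[OF P], of "lincomb ks c"] map_zero by simp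
      moreover have "d a = 0" if "a \<ge> length qs" for a
        using that syzD(2)[OF c(1)] ls(1) by (simp add: c(2) \<theta>'_def)
      ultimately show "d \<in> syz qs" by (simp add: syz_def)
    qed
    show "syz qs \<subseteq> \<theta>' ` syz (ks @ ls)"
    proof
      fix d assume d: "d \<in> syz qs"
      then have "lincomb ls d \<in> ?K"
        using lsP \<theta>ls by (simp add: syzD)
      then obtain c where c: "lincomb ls d = lincomb ks c"
        using ks(1) unfolding hom_gens_def by blast
      let ?c = "vjoin (length ks) (- c) d"
      have "lincomb (ks @ ls) ?c = 0"
        by (simp add: lincomb_vjoin lincomb_uminus c)
      then have c': "?c \<in> syz (ks @ ls)"
        using syzD(2)[OF d] ls(1) by (simp add: syz_def) (simp add: vjoin_def)
      have "\<theta>' ?c = d"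
        by (simp add: \<theta>'_def vjoin_def)
      then show "d \<in> \<theta>' ` syz (ks @ ls)"
        using imageI[OF c', of \<theta>'] by (simp only:)
    qed
  qed
  have "reg_upto k (r + 1) (tk @ tq) (syz (ks @ ls))"
  proof (rule Suc.IH[OF gm])
    show "reg_upto k (r + 1) (tk @ tq) {c \<in> syz (ks @ ls). \<theta>' c = 0}"
      unfolding K' by (rule reg_upto_append[OF ks(3) syz_graded[OF ks(1)]])
    show "reg_upto k (r + 1) tq (\<theta>' ` syz (ks @ ls))"
      unfolding Q' by (rule qs(3))
  qed
  moreover have "\<forall>t\<in>set (tk @ tq). t \<le> r"
    using ks(2) qs(2) by auto
  ultimately show "reg_upto (Suc k) r s P"
    using reg_uptoI[OF gens] by blast
qed simp

text \<open>The extension lemma in the case of a trivial kernel.\<close>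

lemma reg_upto_iso:
  assumes "graded_map s s' P \<theta>" "\<And>v. v \<in> P \<Longrightarrow> \<theta> v = 0 \<Longrightarrow> v = 0" "reg_upto k r s' (\<theta> ` P)"
  shows "reg_upto k r s P"
proof -
  interpret graded_map s s' P \<theta> by fact
  have "{v \<in> P. \<theta> v = 0} = {0}"
    using assms(2) map_zero submoduleD(2)[OF P] by auto
  then have "reg_upto k r s {v \<in> P. \<theta> v = 0}"
    using reg_upto_zero by (simp only:)
  then show ?thesis
    by (rule reg_upto_extension[OF assms(1) _ assms(3)])
qed

lemma vcomp_diff: "vcomp s d (u - v) = vcomp s d u - vcomp s d v"
proof -
  have "vcomp s d (u - v) + vcomp s d v = vcomp s d u"
    by (simp flip: vcomp_add)
  then show ?thesis by (simp add: eq_diff_eq)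
qed

lemma hom_vec_iff: "hom_vec s d v \<longleftrightarrow> v \<in> free_module s \<and> vcomp s d v = v"
  using vcomp_hom[of v s d] vcomp_id[of s d v] by (auto simp: hom_vec_def)

definition trunc :: "nat \<Rightarrow> ('v, 'k::field) fvec \<Rightarrow> ('v, 'k) fvec" where
  "trunc n c = (\<lambda>i. if i < n then c i else 0)"

lemma lincomb_trunc: "lincomb gs (trunc (length gs) c) = lincomb gs c"
  by (rule lincomb_cong) (simp add: trunc_def)

lemma trunc_free: "trunc (length s) c \<in> free_module s"
  by (simp add: trunc_def free_module_def)

lemma trunc_id: "c \<in> free_module s \<Longrightarrow> trunc (length s) c = c"
  by (auto simp: trunc_def free_module_def)

lemma trunc_syz: "lincomb gs c = 0 \<Longrightarrow> trunc (length gs) c \<in> syz gs"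
  using lincomb_trunc[of gs c] by (simp add: syz_def) (simp add: trunc_def)

text \<open>A surjection \<open>\<theta>\<close> onto a free module splits, so the kernel is a quotient of \<open>P\<close> and inherits its
generators. The new syzygies are the coefficient vectors whose combination of the old generators lies
in the complement; they form an extension of the free module by the old syzygies. Since the free
module enters only with these syzygies, its basis may have degrees up to \<open>r + 1\<close>.\<close>

lemma reg_upto_kernel:
  fixes P :: "('v, 'k::field) fvec set"
  assumes gm: "graded_map s us P \<theta>" and onto: "\<theta> ` P = free_module us"
    and us: "\<And>u. u \<in> set us \<Longrightarrow> u \<le> r + 1" and reg: "reg_upto k r s P"
  shows "reg_upto k r s {v \<in> P. \<theta> v = 0}"
proof (cases k)
  case (Suc k')
  interpret graded_map s us P \<theta> by (rule gm)
  obtain ls ts where ls: "hom_gens s P ls ts" and ts: "\<forall>t\<in>set ts. t \<le> r"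
    and regls: "reg_upto k' (r + 1) ts (syz ls)"
    using reg unfolding Suc reg_upto.simps by blast
  have len: "length ls = length ts"
    using ls by (simp add: hom_gens_def)
  let ?es = "map basis [0..<length us] :: ('v, 'k) fvec list"
  have es: "hom_gens us (free_module us) ?es us"
    by (rule hom_gens_free)
  have "length ?es = length us" "\<And>a. a < length ?es \<Longrightarrow> ?es ! a \<in> \<theta> ` P"
    "\<And>a. a < length ?es \<Longrightarrow> hom_vec us (us ! a) (?es ! a)"
    unfolding onto using hom_gens_mem[OF es] es by (simp_all add: hom_gens_def)
  from lift_hom_list[OF this] obtain ps where "length ps = length ?es"
    and \<theta>ps: "map \<theta> ps = ?es"
    and "\<And>a. a < length ?es \<Longrightarrow> ps ! a \<in> P \<and> hom_vec s (us ! a) (ps ! a)"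
    by blast
  then have lenps: "length ps = length us"
    and ps: "\<And>a. a < length ps \<Longrightarrow> ps ! a \<in> P"
    and psh: "\<And>a. a < length ps \<Longrightarrow> hom_vec s (us ! a) (ps ! a)"
    by simp_all
  have psP: "lincomb ps c \<in> P" for c
    by (rule lincomb_in_submodule[OF P ps])
  have \<theta>_ps: "\<theta> (lincomb ps c) = trunc (length us) c" for c
    using map_lincomb[OF ps, of c] by (simp add: \<theta>ps lincomb_basis_list trunc_def)
  have \<theta>_ps': "\<theta> (lincomb ps (\<theta> v)) = \<theta> v" if "v \<in> P" for v
    using \<theta>_ps trunc_id[OF maps[OF that]] by simp
  \<comment> \<open>The projection of \<open>P\<close> onto the kernel of \<open>\<theta>\<close> along the span of the lifted basis vectors \<open>ps\<close>.\<close>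
  define \<pi> where "\<pi> v = v - lincomb ps (\<theta> v)" for v
  have \<pi>P: "\<pi> v \<in> P" if "v \<in> P" for v
    unfolding \<pi>_def using that psP by (rule submoduleD(6)[OF P])
  have \<theta>\<pi>: "\<theta> (\<pi> v) = 0" if "v \<in> P" for v
    unfolding \<pi>_def using map_diff[OF that psP] \<theta>_ps'[OF that] by simp
  have \<pi>_id: "\<pi> v = v" if "\<theta> v = 0" for v
    unfolding \<pi>_def that by simp
  have gm\<pi>: "graded_map s s P \<pi>"
  proof
    fix u v :: "('v, 'k) fvec" and f d assume v: "v \<in> P"
    show "\<pi> v \<in> free_module s"
      by (rule submoduleD(1)[OF P \<pi>P[OF v]])
    show "\<pi> (smul f v) = smul f (\<pi> v)"
      by (rule ext) (simp add: \<pi>_def map_smul[OF v] lincomb_smul algebra_simps)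
    have "vcomp s d (lincomb ps (\<theta> v)) = lincomb ps (vcomp us d (\<theta> v))"
      by (rule lincomb_vcomp[OF lenps psh])
    then show "\<pi> (vcomp s d v) = vcomp s d (\<pi> v)"
      by (simp only: \<pi>_def map_vcomp[OF v] vcomp_diff)
    show "\<pi> (u + v) = \<pi> u + \<pi> v" if "u \<in> P"
      unfolding \<pi>_def map_add[OF that v] lincomb_add by simp
  qed (rule P)
  let ?K = "{v \<in> P. \<theta> v = 0}" and ?ks = "map \<pi> ls"
  have \<pi>ls: "lincomb ?ks c = \<pi> (lincomb ls c)" for c
    using graded_map.map_lincomb[OF gm\<pi> hom_gens_mem[OF ls]] by simp
  have lsP: "lincomb ls c \<in> P" for c
    using ls by (simp add: hom_gens_def)
  have gens: "hom_gens s ?K ?ks ts"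
  proof (rule hom_gensI[OF kernel_graded])
    show "length ?ks = length ts" using len by simp
    fix a assume a: "a < length ?ks"
    then have la: "ls ! a \<in> P" and "hom_vec s (ts ! a) (ls ! a)"
      using hom_gens_mem[OF ls] ls by (simp_all add: hom_gens_def)
    then have "vcomp s (ts ! a) (ls ! a) = ls ! a"
      by (simp add: hom_vec_iff)
    then have "vcomp s (ts ! a) (\<pi> (ls ! a)) = \<pi> (ls ! a)"
      using graded_map.map_vcomp[OF gm\<pi> la, of "ts ! a"] by simp
    then show "hom_vec s (ts ! a) (?ks ! a)"
      using a submoduleD(1)[OF P \<pi>P[OF la]] by (simp add: hom_vec_iff)
    show "?ks ! a \<in> ?K"
      using a \<pi>P[OF la] \<theta>\<pi>[OF la] by simp
  next
    fix v assume v: "v \<in> ?K"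
    then obtain c where "v = lincomb ls c"
      using ls unfolding hom_gens_def by blast
    then have "v = lincomb ?ks c"
      using \<pi>ls[of c] \<pi>_id[of v] v by simp
    then show "\<exists>c. v = lincomb ?ks c" by (rule exI[where x = c])
  qed
  \<comment> \<open>A syzygy of the projected generators is a combination of \<open>ls\<close> in the span of \<open>ps\<close>; \<open>\<Theta>\<close> reads off
    its coordinates there.\<close>
  define \<Theta> where "\<Theta> c = \<theta> (lincomb ls c)" for c
  have gm\<Theta>: "graded_map ts us (syz ?ks) \<Theta>"
  proof
    show "graded_submodule ts (syz ?ks)"
      by (rule syz_graded[OF gens])
    fix u v :: "('v, 'k) fvec" and f d
    show "\<Theta> v \<in> free_module us"
      unfolding \<Theta>_def by (rule maps[OF lsP])
    show "\<Theta> (u + v) = \<Theta> u + \<Theta> v"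
      unfolding \<Theta>_def lincomb_add by (rule map_add[OF lsP lsP])
    show "\<Theta> (smul f v) = smul f (\<Theta> v)"
      unfolding \<Theta>_def lincomb_smul by (rule map_smul[OF lsP])
    have "lincomb ls (vcomp ts d v) = vcomp s d (lincomb ls v)"
      by (rule lincomb_vcomp[symmetric]) (use ls in \<open>simp_all add: hom_gens_def\<close>)
    then show "\<Theta> (vcomp ts d v) = vcomp us d (\<Theta> v)"
      unfolding \<Theta>_def using map_vcomp[OF lsP] by simp
  qed
  have "{c \<in> syz ?ks. \<Theta> c = 0} = syz ls"
  proof (rule Set.set_eqI)
    fix c
    have "lincomb ls c = 0" if "lincomb ?ks c = 0" "\<Theta> c = 0"
      using that \<pi>ls[of c] \<pi>_id[of "lincomb ls c"] unfolding \<Theta>_def by simp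
    moreover have "lincomb ?ks c = 0" "\<Theta> c = 0" if "lincomb ls c = 0"
      using \<pi>ls[of c] \<pi>_id[of "lincomb ls c"] map_zero that unfolding \<Theta>_def by simp_all
    ultimately show "c \<in> {c \<in> syz ?ks. \<Theta> c = 0} \<longleftrightarrow> c \<in> syz ls"
      unfolding syz_def by (simp only: mem_Collect_eq length_map) blast
  qed
  then have "reg_upto k' (r + 1) ts {c \<in> syz ?ks. \<Theta> c = 0}"
    using regls by (simp only:)
  moreover have "\<Theta> ` syz ?ks = free_module us"
  proof
    show "\<Theta> ` syz ?ks \<subseteq> free_module us"
      unfolding \<Theta>_def using maps[OF lsP] by blast
    show "free_module us \<subseteq> \<Theta> ` syz ?ks"
    proof
      fix d :: "('v, 'k) fvec" assume d: "d \<in> free_module us"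
      have \<theta>d: "\<theta> (lincomb ps d) = d"
        unfolding \<theta>_ps by (rule trunc_id[OF d])
      obtain c where c: "lincomb ps d = lincomb ls c"
        using psP[of d] ls unfolding hom_gens_def by blast
      have "lincomb ?ks c = 0"
        unfolding \<pi>ls c[symmetric] unfolding \<pi>_def \<theta>d by simp
      then have c': "trunc (length ls) c \<in> syz ?ks"
        using trunc_syz[of ?ks c] by simp
      have "\<Theta> (trunc (length ls) c) = d"
        unfolding \<Theta>_def lincomb_trunc c[symmetric] by (rule \<theta>d)
      then show "d \<in> \<Theta> ` syz ?ks"
        using imageI[OF c', of \<Theta>] by (simp only:)
    qed
  qed
  then have "reg_upto k' (r + 1) us (\<Theta> ` syz ?ks)"
    using reg_upto_free[OF us] by (simp only:)
  ultimately have "reg_upto k' (r + 1) ts (syz ?ks)"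
    by (rule reg_upto_extension[OF gm\<Theta>])
  then show ?thesis
    unfolding Suc using reg_uptoI[OF gens] ts by blast
qed simp

lemma graded_map_trunc:
  assumes "graded_submodule (s @ s') L"
  shows "graded_map (s @ s') s L (trunc (length s))"
proof
  show "trunc (length s) v \<in> free_module s" for v
    by (rule trunc_free)
  show "trunc (length s) (vcomp (s @ s') d v) = vcomp s d (trunc (length s) v)" for d v
    by (rule ext) (simp add: trunc_def vcomp_def nth_append)
qed (use assms in \<open>auto simp: trunc_def\<close>)

lemma hom_gens_append:
  assumes gs: "hom_gens s N gs ts" and hs: "hom_gens s N hs us"
  shows "hom_gens s N (gs @ hs) (ts @ us)"
proof (rule hom_gensI[OF hom_gens_graded[OF gs]])
  show "length (gs @ hs) = length (ts @ us)"
    using gs hs by (simp add: hom_gens_def)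
  show "hom_vec s ((ts @ us) ! a) ((gs @ hs) ! a)" if "a < length (gs @ hs)" for a
    using that gs hs by (auto simp: nth_append hom_gens_def)
  show "(gs @ hs) ! a \<in> N" if "a < length (gs @ hs)" for a
    using that hom_gens_mem[OF gs] hom_gens_mem[OF hs] by (auto simp: nth_append)
  fix v assume "v \<in> N"
  then obtain c where "v = lincomb gs c"
    using gs unfolding hom_gens_def by blast
  then have "v = lincomb (gs @ hs) (vjoin (length gs) c 0)"
    by (simp add: lincomb_vjoin)
  then show "\<exists>c. v = lincomb (gs @ hs) c"
    by (rule exI[where x = "vjoin (length gs) c 0"])
qed

text \<open>A form of Schanuel's lemma. The module \<open>L\<close> of syzygies of the concatenated list projects onto the
free module belonging to either list, since each generator of one list is a combination of the other
list, and the kernel of each projection is the syzygy module of the other list. So the bound passes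
from \<open>syz gs\<close> up to \<open>L\<close> as an extension and from \<open>L\<close> down to \<open>syz hs\<close> as a kernel.\<close>

proposition reg_upto_change_gens:
  fixes N :: "('v, 'k::field) fvec set"
  assumes gs: "hom_gens s N gs ts" and hs: "hom_gens s N hs us"
    and ts: "\<And>t. t \<in> set ts \<Longrightarrow> t \<le> r" and us: "\<And>u. u \<in> set us \<Longrightarrow> u \<le> r"
    and reg: "reg_upto k r ts (syz gs)"
  shows "reg_upto k r us (syz hs)"
proof -
  have len: "length gs = length ts" "length hs = length us"
    using gs hs by (simp_all add: hom_gens_def)
  let ?L = "syz (gs @ hs)"
  have L: "graded_submodule (ts @ us) ?L"
    by (rule syz_graded[OF hom_gens_append[OF gs hs]])
  have Lmem: "vjoin (length ts) c d \<in> ?L"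
    if "lincomb gs c + lincomb hs d = 0" "d \<in> free_module us" for c d
  proof -
    have "lincomb (gs @ hs) (vjoin (length gs) c d) = 0"
      using that(1) by (simp only: lincomb_vjoin)
    then show ?thesis
      using that(2) len by (simp add: syz_def) (simp add: vjoin_def free_module_def)
  qed
  \<comment> \<open>Up to \<open>L\<close>: projection to the coordinates of \<open>hs\<close>, with kernel \<open>syz gs\<close>.\<close>
  define \<sigma> :: "('v, 'k) fvec \<Rightarrow> ('v, 'k) fvec" where "\<sigma> = (\<lambda>c i. c (i + length ts))"
  have gm\<sigma>: "graded_map (ts @ us) us ?L \<sigma>"
    unfolding \<sigma>_def by (rule graded_map_shift[OF L])
  have "{c \<in> ?L. \<sigma> c = 0} = syz gs"
    unfolding \<sigma>_def len(1)[symmetric] by (rule syz_append_kernel)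
  then have "reg_upto k r (ts @ us) {c \<in> ?L. \<sigma> c = 0}"
    using reg_upto_append[OF reg syz_graded[OF gs]] by (simp only:)
  moreover have "\<sigma> ` ?L = free_module us"
  proof
    show "\<sigma> ` ?L \<subseteq> free_module us"
      using graded_map.maps[OF gm\<sigma>] by blast
    show "free_module us \<subseteq> \<sigma> ` ?L"
    proof
      fix d :: "('v, 'k) fvec" assume d: "d \<in> free_module us"
      have "lincomb hs d \<in> N" using hs by (simp add: hom_gens_def)
      then obtain c where c: "lincomb hs d = lincomb gs c"
        using gs unfolding hom_gens_def by blast
      have "lincomb gs (- c) + lincomb hs d = 0"
        unfolding c lincomb_uminus by simp
      then have "vjoin (length ts) (- c) d \<in> ?L"
        by (rule Lmem[OF _ d])
      from imageI[OF this, of \<sigma>] show "d \<in> \<sigma> ` ?L"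
        by (simp add: \<sigma>_def vjoin_def)
    qed
  qed
  then have "reg_upto k r us (\<sigma> ` ?L)"
    using reg_upto_free[OF us] by (simp only:)
  ultimately have regL: "reg_upto k r (ts @ us) ?L"
    by (rule reg_upto_extension[OF gm\<sigma>])
  \<comment> \<open>Down from \<open>L\<close>: projection to the coordinates of \<open>gs\<close>, with kernel a copy of \<open>syz hs\<close>.\<close>
  let ?\<tau> = "trunc (length ts) :: ('v, 'k) fvec \<Rightarrow> _"
  let ?K = "{c \<in> ?L. ?\<tau> c = 0}"
  have gm\<tau>: "graded_map (ts @ us) ts ?L ?\<tau>"
    by (rule graded_map_trunc[OF L])
  have "?\<tau> ` ?L = free_module ts"
  proof
    show "?\<tau> ` ?L \<subseteq> free_module ts"
      using graded_map.maps[OF gm\<tau>] by blast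
    show "free_module ts \<subseteq> ?\<tau> ` ?L"
    proof
      fix d :: "('v, 'k) fvec" assume d: "d \<in> free_module ts"
      have "lincomb gs d \<in> N" using gs by (simp add: hom_gens_def)
      then obtain c where c: "lincomb gs d = lincomb hs c"
        using hs unfolding hom_gens_def by blast
      have "lincomb hs (trunc (length us) (- c)) = - lincomb hs c"
        using lincomb_trunc[of hs "- c"] by (simp only: len lincomb_uminus)
      then have "lincomb gs d + lincomb hs (trunc (length us) (- c)) = 0"
        unfolding c by simp
      then have "vjoin (length ts) d (trunc (length us) (- c)) \<in> ?L"
        by (rule Lmem[OF _ trunc_free])
      moreover have "?\<tau> (vjoin (length ts) d (trunc (length us) (- c))) = d"
        using d by (auto simp: trunc_def vjoin_def free_module_def)
      ultimately show "d \<in> ?\<tau> ` ?L"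
        by (metis imageI)
    qed
  qed
  then have regK: "reg_upto k r (ts @ us) ?K"
    using ts by (intro reg_upto_kernel[OF gm\<tau> _ _ regL]) force+
  \<comment> \<open>The kernel is \<open>syz hs\<close> moved behind \<open>length ts\<close> zero coordinates.\<close>
  define \<iota> :: "('v, 'k) fvec \<Rightarrow> ('v, 'k) fvec" where "\<iota> = vjoin (length ts) 0"
  have \<iota>: "graded_map us (ts @ us) (syz hs) \<iota>"
  proof
    show "graded_submodule us (syz hs)"
      by (rule syz_graded[OF hs])
    show "\<iota> v \<in> free_module (ts @ us)" if "v \<in> syz hs" for v
      using syzD(2)[OF that] len by (simp add: \<iota>_def vjoin_def free_module_def)
  qed (auto simp: \<iota>_def vjoin_def vcomp_def nth_append)
  have "\<iota> ` syz hs = ?K"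
  proof
    show "\<iota> ` syz hs \<subseteq> ?K"
    proof
      fix c assume "c \<in> \<iota> ` syz hs"
      then obtain d where d: "c = \<iota> d" "d \<in> syz hs" by blast
      have "d \<in> free_module us"
        using submoduleD(1)[OF syz_graded[OF hs] d(2)] .
      then have "c \<in> ?L"
        unfolding d(1) \<iota>_def using syzD(1)[OF d(2)] by (intro Lmem) simp_all
      moreover have "?\<tau> c = 0"
        by (auto simp: d(1) \<iota>_def trunc_def vjoin_def)
      ultimately show "c \<in> ?K" by blast
    qed
    show "?K \<subseteq> \<iota> ` syz hs"
    proof
      fix c assume c: "c \<in> ?K"
      have low: "c i = 0" if "i < length ts" for i
        using c that unfolding trunc_def by (auto dest: fun_cong[where x = i])
      have "lincomb gs c = lincomb gs 0"
        by (rule lincomb_cong) (simp add: low len)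
      then have "lincomb hs (\<sigma> c) = 0"
        using c lincomb_append[of gs hs c] syzD(1)[of c "gs @ hs"] by (simp add: \<sigma>_def len)
      moreover have "\<sigma> c a = 0" if "a \<ge> length hs" for a
        using c that syzD(2)[of c "gs @ hs"] by (simp add: \<sigma>_def len)
      ultimately have "\<sigma> c \<in> syz hs" by (simp add: syz_def)
      moreover have "\<iota> (\<sigma> c) = c"
        by (auto simp: \<iota>_def \<sigma>_def vjoin_def low)
      ultimately show "c \<in> \<iota> ` syz hs"
        by (metis imageI)
    qed
  qed
  then have "reg_upto k r (ts @ us) (\<iota> ` syz hs)"
    using regK by (simp only:)
  moreover have "v = 0" if "\<iota> v = 0" for v
  proof
    fix i show "v i = 0 i"
      using fun_cong[OF that, of "i + length ts"] by (simp add: \<iota>_def vjoin_def)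
  qed
  ultimately show ?thesis
    by (intro reg_upto_iso[OF \<iota>]) blast+
qed

section \<open>Minimal generators\<close>

text \<open>For homogeneous generators, a syzygy with a nonzero constant coefficient would express one generator
by the others, so this is minimality; it is stated so as to match minimality of a resolution.\<close>

definition minimal_gens :: "('v, 'k::field) fvec list \<Rightarrow> bool" where
  "minimal_gens gs \<longleftrightarrow> (\<forall>c\<in>syz gs. \<forall>a. const_coeff (c a) = 0)"

lemma minimal_gensD:
  assumes "minimal_gens gs" "c \<in> syz gs"
  shows "const_coeff (c a) = 0"
  using bspec[OF assms(1)[unfolded minimal_gens_def] assms(2)] by (rule spec)

text \<open>The component of the syzygy in the degree of the \<open>a\<close>-th generator has a nonzero constant as its
\<open>a\<close>-th coordinate. Dividing by this constant eliminates the generator.\<close>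

lemma redundant_generator:
  fixes N :: "('v, 'k::field) fvec set"
  assumes gens: "hom_gens s N gs ts" and c: "c \<in> syz gs" "const_coeff (c a) \<noteq> 0"
  shows "\<exists>hs us. hom_gens s N hs us \<and> length hs < length gs"
proof -
  have len: "length gs = length ts"
    using gens by (simp add: hom_gens_def)
  have a: "a < length gs"
    using c syzD(2)[OF c(1), of a] by (metis lookup_zero not_le)
  let ?A = "take a gs" and ?B = "drop (Suc a) gs" and ?u = "const_coeff (c a)"
  let ?hs = "?A @ ?B" and ?us = "take a ts @ drop (Suc a) ts"
  have gs: "gs = ?A @ [gs ! a] @ ?B"
    using id_take_nth_drop[OF a] by simp
  define c' where "c' = vcomp ts (ts ! a) c"
  have c'a: "c' a = const_poly ?u"
    using homogeneous_0[of "c' a"] by (simp add: c'_def vcomp_def lookup_hcomp)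
  have "lincomb gs c' = 0"
    using submoduleD(5)[OF syz_graded[OF gens] c(1)] unfolding c'_def by (rule syzD(1))
  moreover have "lincomb gs c' = lincomb ?A c' + (smul (c' a) (gs ! a) + lincomb ?B (\<lambda>i. c' (i + Suc a)))"
  proof -
    have "lincomb [gs ! a] d = smul (d 0) (gs ! a)" for d
      by (auto simp: lincomb_def)
    moreover have "length ?A = a" using a by simp
    ultimately show ?thesis
      by (subst gs) (simp only: lincomb_append, simp add: add_ac)
  qed
  moreover have "y = - (x + z)" if "0 = x + (y + z)" for x y z :: "('v, 'k) fvec"
  proof -
    have "y = x + (y + z) - (x + z)"
      by (simp add: algebra_simps)
    then show ?thesis
      unfolding that[symmetric] by simp
  qed
  ultimately have "smul (c' a) (gs ! a) = - (lincomb ?A c' + lincomb ?B (\<lambda>i. c' (i + Suc a)))"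
    by simp
  also have "\<dots> = - lincomb ?hs (vjoin (length ?A) c' (\<lambda>i. c' (i + Suc a)))"
    unfolding lincomb_vjoin ..
  finally have eq: "smul (c' a) (gs ! a) = - lincomb ?hs (vjoin (length ?A) c' (\<lambda>i. c' (i + Suc a)))" .
  have "gs ! a = smul (const_poly (1 / ?u)) (smul (c' a) (gs ! a))"
    using c(2) by (auto simp: c'a mult.assoc[symmetric] const_poly_mult const_poly_1)
  then have ga: "gs ! a \<in> range (lincomb ?hs)"
    unfolding eq by (metis lincomb_smul lincomb_uminus rangeI)
  have hs: "hom_gens s (range (lincomb ?hs)) ?hs ?us"
    using gens a by (auto simp: hom_gens_def nth_append)
  have "gs ! b \<in> range (lincomb ?hs)" if b: "b < length gs" for b
  proof -
    consider "b = a" | "b < a" | "a < b" by linarith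
    then show ?thesis
    proof cases
      case 1 with ga show ?thesis by simp
    next
      case 2
      then show ?thesis
        using hom_gens_mem[OF hs, of b] a by (simp add: nth_append)
    next
      case 3
      then have "\<not> b - 1 < a" by arith
      have "?hs ! (b - 1) = gs ! b" "b - 1 < length ?hs"
        using 3 a b \<open>\<not> b - 1 < a\<close> by (simp_all add: nth_append min_def)
      then show ?thesis
        using hom_gens_mem[OF hs, of "b - 1"] by simp
    qed
  qed
  then have "lincomb gs d \<in> range (lincomb ?hs)" for d
    by (rule lincomb_in_submodule[OF hom_gens_graded[OF hs]])
  then have "N \<subseteq> range (lincomb ?hs)"
    using gens by (auto simp: hom_gens_def)
  moreover have "?hs ! b \<in> N" if "b < length ?hs" for b
    using that hom_gens_mem[OF gens] a by (auto simp: nth_append)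
  then have "lincomb ?hs d \<in> N" for d
    by (rule lincomb_in_submodule[OF hom_gens_graded[OF gens]])
  then have "range (lincomb ?hs) \<subseteq> N" by blast
  ultimately have "hom_gens s N ?hs ?us"
    using hs by simp
  moreover have "length ?hs < length gs" using a by simp
  ultimately show ?thesis by blast
qed

lemma minimal_gens_exist:
  assumes "hom_gens s N gs ts"
  shows "\<exists>hs us. hom_gens s N hs us \<and> minimal_gens hs"
  using assms
proof (induction "length gs" arbitrary: gs ts rule: less_induct)
  case less
  show "\<exists>hs us. hom_gens s N hs us \<and> minimal_gens hs"
  proof (cases "minimal_gens gs")
    case True
    with less.prems show ?thesis by blast
  next
    case False
    then obtain c a where "c \<in> syz gs" "const_coeff (c a) \<noteq> 0"
      unfolding minimal_gens_def by blast
    from redundant_generator[OF less.prems this] less.hyps show ?thesis by blast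
  qed
qed

text \<open>If a generator \<open>h\<close> had degree above \<open>r\<close>, its coefficients in terms of \<open>gs\<close> would have positive degree.
Rewriting \<open>gs\<close> in terms of \<open>hs\<close> then expresses \<open>h\<close> by \<open>hs\<close> with coefficients without constant term,
and moving \<open>h\<close> to the other side gives a syzygy with constant coefficient 1 at \<open>h\<close>.\<close>

lemma minimal_gens_degree:
  fixes N :: "('v, 'k::field) fvec set"
  assumes gs: "hom_gens s N gs ts" and ts: "\<And>t. t \<in> set ts \<Longrightarrow> t \<le> r"
    and hs: "hom_gens s N hs us" and min: "minimal_gens hs" and u: "u \<in> set us"
  shows "u \<le> r"
proof (rule ccontr)
  assume "\<not> u \<le> r"
  obtain b where b: "b < length hs" "u = us ! b"
    using u hs by (auto simp: hom_gens_def in_set_conv_nth)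
  have len: "length gs = length ts" using gs by (simp add: hom_gens_def)
  obtain c0 where c0: "hs ! b = lincomb gs c0"
    using hom_gens_mem[OF hs b(1)] gs unfolding hom_gens_def by blast
  define c where "c = vcomp ts u c0"
  have "hom_vec s u (hs ! b)"
    using hs b by (simp add: hom_gens_def)
  then have "vcomp s u (hs ! b) = hs ! b"
    by (rule vcomp_id)
  moreover have "vcomp s u (lincomb gs c0) = lincomb gs c"
    unfolding c_def by (rule lincomb_vcomp) (use gs in \<open>simp_all add: hom_gens_def\<close>)
  ultimately have c: "hs ! b = lincomb gs c"
    by (simp add: c0)
  have c_const: "const_coeff (c a) = 0" if "a < length gs" for a
  proof -
    have "ts ! a \<in> set ts" using that len by simp
    from ts[OF this] \<open>\<not> u \<le> r\<close> show ?thesis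
      by (intro const_coeff_homogeneous[of _ "u - ts ! a"]) (simp_all add: c_def vcomp_def)
  qed
  have "\<forall>a. \<exists>d. a < length gs \<longrightarrow> gs ! a = lincomb hs d"
    using hom_gens_mem[OF gs] hs unfolding hom_gens_def by blast
  from choice[OF this] obtain D where D: "\<And>a. a < length gs \<Longrightarrow> gs ! a = lincomb hs (D a)"
    by blast
  define e where "e = (\<lambda>b'. \<Sum>a<length gs. c a * D a b')"
  have "lincomb hs e = hs ! b"
  proof
    fix i
    have "lincomb hs e i = (\<Sum>b'<length hs. \<Sum>a<length gs. c a * D a b' * (hs ! b') i)"
      by (simp add: lincomb_def e_def sum_distrib_right)
    also have "\<dots> = (\<Sum>a<length gs. c a * lincomb hs (D a) i)"
      by (subst sum.swap) (simp add: lincomb_def sum_distrib_left mult.assoc)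
    also have "\<dots> = lincomb gs c i"
      by (simp add: lincomb_def[of gs] D)
    finally show "lincomb hs e i = (hs ! b) i" by (simp add: c)
  qed
  then have "lincomb hs (basis b - e) = 0"
    by (simp add: lincomb_diff lincomb_basis[OF b(1)])
  then have "trunc (length hs) (basis b - e) \<in> syz hs"
    by (rule trunc_syz)
  then have "const_coeff (trunc (length hs) (basis b - e) b) = 0"
    using min by (simp add: minimal_gens_def)
  moreover have "const_coeff (e b) = 0"
    by (simp add: e_def lookup_sum c_const const_coeff_mult_zero)
  ultimately show False
    using b(1) by (simp add: trunc_def basis_def lookup_minus)
qed

definition reg_le :: "int \<Rightarrow> int list \<Rightarrow> ('v, 'k::field) fvec set \<Rightarrow> bool" where
  "reg_le r s N \<longleftrightarrow> (\<forall>k. reg_upto k r s N)"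

lemma reg_le_minimal_gens_exist:
  assumes "reg_le r s N"
  shows "\<exists>hs us. hom_gens s N hs us \<and> minimal_gens hs"
proof -
  have "reg_upto (Suc 0) r s N"
    using assms by (simp only: reg_le_def)
  then obtain gs ts where "hom_gens s N gs ts"
    unfolding reg_upto.simps by blast
  then show ?thesis by (rule minimal_gens_exist)
qed

text \<open>With minimal generators the shift bound continues to the next syzygy module. This is the step from
which minimal resolutions are both constructed and bounded.\<close>

theorem reg_le_minimal_gens:
  assumes "reg_le r s N" and hs: "hom_gens s N hs us" and min: "minimal_gens hs"
  shows "u \<in> set us \<Longrightarrow> u \<le> r" and "reg_le (r + 1) us (syz hs)"
proof -
  have *: "(\<forall>u\<in>set us. u \<le> r) \<and> reg_upto k (r + 1) us (syz hs)" for k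
  proof -
    have "reg_upto (Suc k) r s N"
      using assms(1) by (simp only: reg_le_def)
    then obtain gs ts where gs: "hom_gens s N gs ts" and ts: "\<forall>t\<in>set ts. t \<le> r"
      and reg: "reg_upto k (r + 1) ts (syz gs)"
      unfolding reg_upto.simps by blast
    have us: "u \<le> r" if "u \<in> set us" for u
      using minimal_gens_degree[OF gs _ hs min that] ts by blast
    have "reg_upto k (r + 1) us (syz hs)"
      using ts us by (intro reg_upto_change_gens[OF gs hs _ _ reg]) force+
    with us show ?thesis by blast
  qed
  then show "u \<in> set us \<Longrightarrow> u \<le> r" by blast
  show "reg_le (r + 1) us (syz hs)"
    using * by (simp add: reg_le_def)
qed

section \<open>Squarefree monomial ideals\<close>

text \<open>The ideal generated by the squarefree monomials with supports in \<open>E\<close>, described by the monomials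
it contains. The sets in \<open>E\<close> can have any size: \<open>{v}\<close> stands for the variable \<open>v\<close>, and \<open>{}\<close> for 1.\<close>

definition sf_ideal :: "'v set set \<Rightarrow> ('v, 'k::field) mpoly set" where
  "sf_ideal E = {f. \<forall>m\<in>Poly_Mapping.keys f. \<exists>e\<in>E. e \<subseteq> Poly_Mapping.keys m}"

definition ideal_vecs :: "('v, 'k::field) mpoly set \<Rightarrow> ('v, 'k) fvec set" where
  "ideal_vecs J = {v. v 0 \<in> J \<and> (\<forall>i>0. v i = 0)}"

lemma keys_add_monom:
  fixes a b :: "'v \<Rightarrow>\<^sub>0 nat"
  shows "Poly_Mapping.keys (a + b) = Poly_Mapping.keys a \<union> Poly_Mapping.keys b"
  by (auto simp: in_keys_iff lookup_add)

lemma sf_ideal_zero: "0 \<in> sf_ideal E"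
  by (simp add: sf_ideal_def)

lemma sf_ideal_add: "f \<in> sf_ideal E \<Longrightarrow> g \<in> sf_ideal E \<Longrightarrow> f + g \<in> sf_ideal E"
  using keys_add[of f g] unfolding sf_ideal_def by fast

lemma sf_ideal_mult:
  assumes "g \<in> sf_ideal E"
  shows "f * g \<in> sf_ideal E"
  unfolding sf_ideal_def mem_Collect_eq
proof
  fix m assume "m \<in> Poly_Mapping.keys (f * g)"
  then obtain a b where ab: "m = a + b" "b \<in> Poly_Mapping.keys g"
    using keys_mult[of f g] by auto
  then obtain e where "e \<in> E" "e \<subseteq> Poly_Mapping.keys b"
    using assms unfolding sf_ideal_def by fast
  then show "\<exists>e\<in>E. e \<subseteq> Poly_Mapping.keys m"
    using ab(1) keys_add_monom[of a b] by auto
qed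

lemma sf_ideal_hcomp: "f \<in> sf_ideal E \<Longrightarrow> hcomp d f \<in> sf_ideal E"
  by (auto simp: sf_ideal_def in_keys_iff lookup_hcomp split: if_splits)

lemma sf_ideal_graded: "graded_submodule [d] (ideal_vecs (sf_ideal E))"
  unfolding graded_submodule_def
proof (intro conjI)
  show "ideal_vecs (sf_ideal E) \<subseteq> free_module [d]"
    by (auto simp: ideal_vecs_def free_module_def)
qed (simp_all add: ideal_vecs_def sf_ideal_zero sf_ideal_add sf_ideal_mult vcomp_def sf_ideal_hcomp)

definition sf_monom :: "'v set \<Rightarrow> ('v \<Rightarrow>\<^sub>0 nat)" where
  "sf_monom A = (\<Sum>v\<in>A. Poly_Mapping.single v 1)"

lemma lookup_sf_monom:
  "finite A \<Longrightarrow> Poly_Mapping.lookup (sf_monom A) v = (if v \<in> A then 1 else 0)"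
  by (simp add: sf_monom_def lookup_sum lookup_single when_def cong: if_cong)

lemma keys_sf_monom: "finite A \<Longrightarrow> Poly_Mapping.keys (sf_monom A) = A"
  by (simp add: set_eq_iff in_keys_iff lookup_sf_monom)

lemma degree_sf_monom: "finite A \<Longrightarrow> monom_degree (sf_monom A) = card A"
  by (simp add: monom_degree_def keys_sf_monom lookup_sf_monom)

lemma sum_monomials:
  "(\<Sum>m\<in>Poly_Mapping.keys f. Poly_Mapping.single m (Poly_Mapping.lookup f m)) = f"
  by (rule poly_mapping_eqI)
    (simp add: lookup_sum lookup_single when_def in_keys_iff cong: if_cong)

lemma lookup_mult_monom:
  fixes f :: "('v, 'k::field) mpoly"
  shows "Poly_Mapping.lookup (f * Poly_Mapping.single \<mu> 1) (a + \<mu>) = Poly_Mapping.lookup f a"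
proof -
  have "f * Poly_Mapping.single \<mu> 1 =
      (\<Sum>m\<in>Poly_Mapping.keys f. Poly_Mapping.single m (Poly_Mapping.lookup f m)) * Poly_Mapping.single \<mu> 1"
    by (simp only: sum_monomials)
  also have "\<dots> = (\<Sum>m\<in>Poly_Mapping.keys f. Poly_Mapping.single (m + \<mu>) (Poly_Mapping.lookup f m))"
    by (simp add: sum_distrib_right mult_single)
  finally show ?thesis
    by (simp add: lookup_sum lookup_single when_def in_keys_iff cong: if_cong)
qed

text \<open>Multiplication by a monomial \<open>\<mu>\<close> translates the monomials of \<open>f\<close> by \<open>\<mu>\<close>, which adds \<open>A\<close> to their supports.\<close>

lemma colon_sf_ideal:
  assumes "finite A"
  shows "f * Poly_Mapping.single (sf_monom A) 1 \<in> sf_ideal E \<longleftrightarrow> f \<in> sf_ideal ((\<lambda>e. e - A) ` E)"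
    (is "?g \<in> _ \<longleftrightarrow> _")
proof -
  let ?\<mu> = "sf_monom A"
  have "Poly_Mapping.keys ?g = (\<lambda>a. a + ?\<mu>) ` Poly_Mapping.keys f"
  proof
    show "Poly_Mapping.keys ?g \<subseteq> (\<lambda>a. a + ?\<mu>) ` Poly_Mapping.keys f"
      using keys_mult[of f "Poly_Mapping.single ?\<mu> 1"] by auto
    show "(\<lambda>a. a + ?\<mu>) ` Poly_Mapping.keys f \<subseteq> Poly_Mapping.keys ?g"
      by (auto simp: in_keys_iff lookup_mult_monom)
  qed
  moreover have "e \<subseteq> Poly_Mapping.keys (a + ?\<mu>) \<longleftrightarrow> e - A \<subseteq> Poly_Mapping.keys a" for e a
    using assms by (auto simp: keys_add_monom keys_sf_monom)
  ultimately show ?thesis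
    by (simp add: sf_ideal_def)
qed

text \<open>A monomial of \<open>f\<close> whose support contains no \<open>e \<in> E\<close> must be divisible by the monomial of \<open>A\<close>.\<close>

lemma split_sf_ideal:
  fixes f :: "('v, 'k::field) mpoly"
  assumes "finite A" and f: "f \<in> sf_ideal (insert A E)"
  shows "\<exists>u\<in>sf_ideal E. \<exists>h. f = u + h * Poly_Mapping.single (sf_monom A) 1"
proof -
  let ?\<mu> = "sf_monom A"
  let ?term = "\<lambda>m. Poly_Mapping.single m (Poly_Mapping.lookup f m) :: ('v, 'k) mpoly"
  define B where "B = {m \<in> Poly_Mapping.keys f. \<exists>e\<in>E. e \<subseteq> Poly_Mapping.keys m}"
  define C where "C = Poly_Mapping.keys f - B"
  define h where "h = (\<Sum>m\<in>C. Poly_Mapping.single (m - ?\<mu>) (Poly_Mapping.lookup f m))"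
  have "m - ?\<mu> + ?\<mu> = m" if "m \<in> C" for m
  proof (rule poly_mapping_eqI)
    fix v
    have "A \<subseteq> Poly_Mapping.keys m"
      using that f by (auto simp: C_def B_def sf_ideal_def)
    then have "v \<in> A \<Longrightarrow> Poly_Mapping.lookup m v > 0"
      by (auto simp: in_keys_iff)
    then show "Poly_Mapping.lookup (m - ?\<mu> + ?\<mu>) v = Poly_Mapping.lookup m v"
      using assms(1) by (simp add: lookup_add lookup_minus lookup_sf_monom)
  qed
  then have "h * Poly_Mapping.single ?\<mu> 1 = (\<Sum>m\<in>C. ?term m)"
    by (simp add: h_def sum_distrib_right mult_single)
  moreover have "f = (\<Sum>m\<in>B. ?term m) + (\<Sum>m\<in>C. ?term m)"
  proof -
    have "f = (\<Sum>m\<in>Poly_Mapping.keys f. ?term m)"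
      by (simp only: sum_monomials)
    also have "\<dots> = (\<Sum>m\<in>C. ?term m) + (\<Sum>m\<in>B. ?term m)"
      unfolding C_def by (rule sum.subset_diff) (auto simp: B_def)
    finally show ?thesis by (simp add: add.commute)
  qed
  moreover have "(\<Sum>m\<in>B. ?term m) \<in> sf_ideal E"
  proof -
    have "?term m \<in> sf_ideal E" if "m \<in> B" for m
      using that by (auto simp: sf_ideal_def B_def)
    moreover have "finite B" by (simp add: B_def)
    ultimately show ?thesis
      by (induction B rule: infinite_finite_induct) (auto simp: sf_ideal_zero sf_ideal_add)
  qed
  ultimately show ?thesis
    by (intro bexI[where x = "\<Sum>m\<in>B. ?term m"] exI[where x = h]) (simp_all only:)
qed

lemma reg_upto_shift:
  "reg_upto k r s N \<Longrightarrow> reg_upto k (r + d) (map (\<lambda>t. t + d) s) (N :: ('v, 'k::field) fvec set)"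
proof (induction k arbitrary: r s N)
  case (Suc k)
  obtain gs ts where gs: "hom_gens s N gs ts" and ts: "\<forall>t\<in>set ts. t \<le> r"
    and reg: "reg_upto k (r + 1) ts (syz gs)"
    using Suc.prems unfolding reg_upto.simps by blast
  have "hom_vec (map (\<lambda>t. t + d) s) (t + d) v" if v: "hom_vec s t v" for t and v :: "('v, 'k) fvec"
    unfolding hom_vec_def
  proof (intro conjI allI)
    show "v \<in> free_module (map (\<lambda>t. t + d) s)"
      using v by (simp add: hom_vec_def free_module_def)
    show "v i \<in> homogeneous_part (t + d - map (\<lambda>t. t + d) s ! i)" for i
      using v by (cases "i < length s") (simp_all add: hom_vec_def free_module_def)
  qed
  then have gens: "hom_gens (map (\<lambda>t. t + d) s) N gs (map (\<lambda>t. t + d) ts)"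
    using gs by (simp add: hom_gens_def)
  have "reg_upto k (r + d + 1) (map (\<lambda>t. t + d) ts) (syz gs)"
    using Suc.IH[OF reg] by (simp add: add_ac)
  then show "reg_upto (Suc k) (r + d) (map (\<lambda>t. t + d) s) N"
    using ts by (intro reg_uptoI[OF gens]) auto
qed simp

text \<open>Append \<open>g\<close> to a list of generators of \<open>N\<close>. The last coordinates of the syzygies of the longer list
form the colon ideal \<open>(N : g)\<close>, placed in degree \<open>e\<close>, and the syzygies with last coordinate zero
are those of the old list.\<close>

proposition reg_upto_add_generator:
  fixes N :: "('v, 'k::field) fvec set"
  assumes N': "graded_submodule s N'" and "N \<subseteq> N'" and g: "g \<in> N'" "hom_vec s e g" "e \<le> r"
    and sum: "\<And>v. v \<in> N' \<Longrightarrow> \<exists>u\<in>N. \<exists>f. v = u + smul f g"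
    and N: "reg_upto k r s N"
    and Q: "reg_upto k (r + 1) [e] {c \<in> free_module [e]. smul (c 0) g \<in> N}"
  shows "reg_upto k r s N'"
proof (cases k)
  case (Suc k')
  obtain gs ts where gs: "hom_gens s N gs ts" and ts: "\<forall>t\<in>set ts. t \<le> r"
    and reg: "reg_upto k' (r + 1) ts (syz gs)"
    using N unfolding Suc reg_upto.simps by blast
  have len: "length gs = length ts" using gs by (simp add: hom_gens_def)
  have sing: "lincomb [g] d = smul (d 0) g" for d
    by (auto simp: lincomb_def)
  have gens: "hom_gens s N' (gs @ [g]) (ts @ [e])"
  proof (rule hom_gensI[OF N'])
    show "length (gs @ [g]) = length (ts @ [e])" using len by simp
    show "hom_vec s ((ts @ [e]) ! a) ((gs @ [g]) ! a)" if "a < length (gs @ [g])" for a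
      using that gs g(2) by (auto simp: nth_append hom_gens_def less_Suc_eq)
    show "(gs @ [g]) ! a \<in> N'" if "a < length (gs @ [g])" for a
      using that hom_gens_mem[OF gs, of a] \<open>N \<subseteq> N'\<close> g(1) by (auto simp: nth_append less_Suc_eq)
    fix v assume "v \<in> N'"
    then obtain u f where uf: "u \<in> N" "v = u + smul f g" using sum by blast
    then obtain c where "u = lincomb gs c"
      using gs unfolding hom_gens_def by blast
    then have "v = lincomb (gs @ [g]) (vjoin (length gs) c (\<lambda>_. f))"
      by (simp add: lincomb_vjoin sing uf(2))
    then show "\<exists>c. v = lincomb (gs @ [g]) c"
      by (rule exI[where x = "vjoin (length gs) c (\<lambda>_. f)"])
  qed
  let ?L = "syz (gs @ [g])"
  define \<sigma> :: "('v, 'k) fvec \<Rightarrow> ('v, 'k) fvec" where "\<sigma> = (\<lambda>c i. c (i + length ts))"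
  have gm\<sigma>: "graded_map (ts @ [e]) [e] ?L \<sigma>"
    unfolding \<sigma>_def by (rule graded_map_shift[OF syz_graded[OF gens]])
  have "{c \<in> ?L. \<sigma> c = 0} = syz gs"
    unfolding \<sigma>_def len[symmetric] by (rule syz_append_kernel)
  then have "reg_upto k' (r + 1) (ts @ [e]) {c \<in> ?L. \<sigma> c = 0}"
    using reg_upto_append[OF reg syz_graded[OF gs]] by (simp only:)
  moreover have "\<sigma> ` ?L = {c \<in> free_module [e]. smul (c 0) g \<in> N}" (is "_ = ?Q")
  proof
    show "\<sigma> ` ?L \<subseteq> ?Q"
    proof
      fix d assume "d \<in> \<sigma> ` ?L"
      then obtain c where c: "d = \<sigma> c" "c \<in> ?L" by blast
      have "lincomb gs c + smul (d 0) g = 0"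
        using syzD(1)[OF c(2)] by (simp add: lincomb_append sing c(1) \<sigma>_def len)
      then have "smul (d 0) g = lincomb gs (- c)"
        by (simp add: lincomb_uminus eq_neg_iff_add_eq_0 add_ac)
      then have "smul (d 0) g \<in> N"
        using gs by (simp add: hom_gens_def)
      then show "d \<in> ?Q"
        using graded_map.maps[OF gm\<sigma> c(2)] c(1) by blast
    qed
    show "?Q \<subseteq> \<sigma> ` ?L"
    proof
      fix d assume d: "d \<in> ?Q"
      then obtain c where c: "smul (d 0) g = lincomb gs c"
        using gs unfolding hom_gens_def by blast
      have "lincomb (gs @ [g]) (vjoin (length gs) (- c) d) = 0"
        unfolding lincomb_vjoin lincomb_uminus sing c by simp
      then have "vjoin (length ts) (- c) d \<in> ?L"
        using d by (simp add: syz_def len) (simp add: vjoin_def free_module_def)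
      from imageI[OF this, of \<sigma>] show "d \<in> \<sigma> ` ?L"
        by (simp add: \<sigma>_def vjoin_def)
    qed
  qed
  then have "reg_upto k' (r + 1) [e] (\<sigma> ` ?L)"
    using reg_upto_Suc[OF Q[unfolded Suc]] by (simp only:)
  ultimately have "reg_upto k' (r + 1) (ts @ [e]) ?L"
    by (rule reg_upto_extension[OF gm\<sigma>])
  then show ?thesis
    unfolding Suc using ts g(3) by (intro reg_uptoI[OF gens]) auto
qed simp

text \<open>Here the colon ideal is again squarefree, so that the bound can be iterated.\<close>

proposition reg_upto_insert:
  fixes E :: "'v set set"
  assumes A: "finite A" "int (card A) \<le> r"
    and E: "reg_upto k r [0] (ideal_vecs (sf_ideal E :: ('v, 'k::field) mpoly set))"
    and colon: "reg_upto k (r + 1 - int (card A)) [0]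
      (ideal_vecs (sf_ideal ((\<lambda>e. e - A) ` E) :: ('v, 'k) mpoly set))"
  shows "reg_upto k r [0] (ideal_vecs (sf_ideal (insert A E) :: ('v, 'k) mpoly set))"
proof -
  let ?e = "int (card A)" and ?x = "Poly_Mapping.single (sf_monom A) 1 :: ('v, 'k) mpoly"
  define g :: "('v, 'k) fvec" where "g = (\<lambda>i. if i = 0 then ?x else 0)"
  show ?thesis
  proof (rule reg_upto_add_generator[OF sf_ideal_graded _ _ _ A(2) _ E])
    show "ideal_vecs (sf_ideal E) \<subseteq> ideal_vecs (sf_ideal (insert A E) :: ('v, 'k) mpoly set)"
      by (auto simp: ideal_vecs_def sf_ideal_def)
    show "g \<in> ideal_vecs (sf_ideal (insert A E))"
      using A(1) by (simp add: ideal_vecs_def sf_ideal_def g_def keys_sf_monom)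
    show "hom_vec [0] ?e g"
      using A(1) by (simp add: hom_vec_def free_module_def g_def homogeneous_part_def degree_sf_monom)
    show "\<exists>u\<in>ideal_vecs (sf_ideal E). \<exists>f. v = u + smul f g"
      if v: "v \<in> ideal_vecs (sf_ideal (insert A E))" for v
    proof -
      have "v 0 \<in> sf_ideal (insert A E)"
        using v by (simp add: ideal_vecs_def)
      from split_sf_ideal[OF A(1) this]
      obtain u f where u: "u \<in> sf_ideal E" "v 0 = u + f * ?x" by blast
      let ?u = "\<lambda>i::nat. if i = 0 then u else 0"
      have "v = ?u + smul f g"
        using u(2) v by (auto simp: ideal_vecs_def g_def)
      moreover have "?u \<in> ideal_vecs (sf_ideal E)"
        using u(1) by (simp add: ideal_vecs_def)
      ultimately show ?thesis by blast
    qed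
    have "{c \<in> free_module [?e]. smul (c 0) g \<in> ideal_vecs (sf_ideal E)} =
        ideal_vecs (sf_ideal ((\<lambda>e. e - A) ` E))"
      by (auto simp: free_module_def ideal_vecs_def g_def colon_sf_ideal[OF A(1)] Suc_le_eq)
    then show "reg_upto k (r + 1) [?e] {c \<in> free_module [?e]. smul (c 0) g \<in> ideal_vecs (sf_ideal E)}"
      using reg_upto_shift[OF colon, of ?e] by simp
  qed
qed

section \<open>Matching number and regularity\<close>

definition matching :: "'v set set \<Rightarrow> bool" where
  "matching M \<longleftrightarrow> (\<forall>e\<in>M. card e = 2) \<and> (\<forall>e\<in>M. \<forall>f\<in>M. e \<noteq> f \<longrightarrow> e \<inter> f = {})"

text \<open>Induction on the number of generators, removing one generator \<open>A\<close>. Sets with fewer than two elements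
must be admitted because the colon ideal by an edge contains the neighbours of its ends as variables;
they are ignored by \<open>matching\<close>.\<close>

theorem reg_le_matching_number:
  fixes E :: "'v::finite set set"
  assumes "\<And>e. e \<in> E \<Longrightarrow> card e \<le> 2"
    and "\<And>M. M \<subseteq> E \<Longrightarrow> matching M \<Longrightarrow> card M \<le> r"
  shows "reg_upto k (int r + 1) [0] (ideal_vecs (sf_ideal E :: ('v, 'k::field) mpoly set))"
  using assms
proof (induction "card E" arbitrary: E r rule: less_induct)
  case less
  show ?case
  proof (cases "E = {}")
    case True
    have "ideal_vecs (sf_ideal {} :: ('v, 'k) mpoly set) = {0}"
      by (auto simp: ideal_vecs_def sf_ideal_def keys_eq_empty fun_eq_iff) (metis gr0I)
    then show ?thesis
      unfolding True by (simp only: reg_upto_zero)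
  next
    case False
    then obtain A where A: "A \<in> E" by blast
    define E' where "E' = E - {A}"
    define E'' where "E'' = (\<lambda>e. e - A) ` E'"
    have E: "E = insert A E'" "A \<notin> E'" using A by (auto simp: E'_def)
    have card: "card E' < card E" "card E'' < card E"
      using card_image_le[of E' "\<lambda>e. e - A"] E by (auto simp: E''_def)
    have cardA: "card A \<le> 2" using less.prems(1) A .
    \<comment> \<open>A two-element set \<open>e' - A\<close> with \<open>card e' \<le> 2\<close> is \<open>e'\<close> itself.\<close>
    have disj: "e \<in> E' \<and> e \<inter> A = {}" if e: "e \<in> E''" "card e = 2" for e
    proof -
      obtain e' where e': "e' \<in> E'" "e = e' - A" using e(1) unfolding E''_def by blast
      then have "card e' \<le> 2" using less.prems(1)[of e'] E(1) by blast
      then have "e = e'" using e' e(2) by (intro card_seteq) auto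
      then show ?thesis using e' by blast
    qed
    have matchE: "M \<subseteq> E'" if M: "M \<subseteq> E''" "matching M" for M
      using M disj unfolding matching_def by blast
    have 1: "reg_upto k (int r + 1) [0] (ideal_vecs (sf_ideal E' :: ('v, 'k) mpoly set))"
      using less.prems E(1) by (intro less.hyps card(1)) blast+
    have small: "card e \<le> 2" if e: "e \<in> E''" for e
    proof -
      obtain e' where e': "e' \<in> E'" "e = e' - A" using e unfolding E''_def by blast
      then have "card e \<le> card e'" by (intro card_mono) auto
      then show ?thesis using less.prems(1)[of e'] e'(1) E(1) by force
    qed
    have 2: "reg_upto k (int r + 1 + 1 - int (card A)) [0] (ideal_vecs (sf_ideal E'' :: ('v, 'k) mpoly set))"
    proof (cases "card A = 2")
      case True
      \<comment> \<open>Matchings of the colon ideal extend by \<open>A\<close>. The gain of one makes up for the shift by two,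
      of which the passage to syzygies absorbs the other unit.\<close>
      have ins: "card M + 1 \<le> r" if M: "M \<subseteq> E''" "matching M" for M
      proof -
        have "e \<inter> A = {}" if "e \<in> M" for e
          using that M disj unfolding matching_def by blast
        moreover have "A \<notin> M" using matchE[OF M] E(2) by blast
        moreover have "matching (insert A M)"
          using M(2) True calculation(1) unfolding matching_def by blast
        moreover have "insert A M \<subseteq> E" using matchE[OF M] E(1) by blast
        ultimately show ?thesis
          using less.prems(2)[of "insert A M"] by simp
      qed
      have "reg_upto k (int (r - 1) + 1) [0] (ideal_vecs (sf_ideal E'' :: ('v, 'k) mpoly set))"
      proof (rule less.hyps[OF card(2) small])
        show "card M \<le> r - 1" if "M \<subseteq> E''" "matching M" for M
          using ins[OF that] by simp
      qed
      moreover have "1 \<le> r"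
        using ins[of "{}"] by (simp add: matching_def)
      ultimately show ?thesis using True by (simp add: of_nat_diff)
    next
      case False
      have "reg_upto k (int r + 1) [0] (ideal_vecs (sf_ideal E'' :: ('v, 'k) mpoly set))"
      proof (rule less.hyps[OF card(2) small])
        show "card M \<le> r" if "M \<subseteq> E''" "matching M" for M
          using less.prems(2)[of M] matchE[OF that] that(2) E(1) by blast
      qed
      then show ?thesis
        by (rule reg_upto_mono) (use False cardA in simp)
    qed
    have "int (card A) \<le> int r + 1"
    proof (cases "card A = 2")
      case True
      then have "card {A} \<le> r"
        using A by (intro less.prems(2)) (simp_all add: matching_def)
      with True show ?thesis by simp
    qed (use cardA in simp)
    then show ?thesis
      unfolding E(1) using reg_upto_insert[OF _ _ 1] 2 unfolding E''_def by simp
  qed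
qed

section \<open>Matchings in trees\<close>

lemma matching_card_Union:
  fixes M :: "'v::finite set set"
  assumes "matching M"
  shows "card (\<Union>M) = 2 * card M"
proof -
  have "card (\<Union>M) = sum card M"
    using assms by (intro card_Union_disjoint) (auto simp: matching_def pairwise_def disjnt_def)
  also have "\<dots> = sum (\<lambda>_. 2) M"
    using assms by (intro sum.cong) (simp_all add: matching_def)
  finally show ?thesis by simp
qed

text \<open>From a vertex of \<open>e\<close> the only edge is \<open>e\<close>, so no walk leaves \<open>e\<close>.\<close>

lemma pendant_edge_is_component:
  fixes E :: "'v::finite set set"
  assumes conn: "connected_graph E" and e: "e \<in> E" "e \<noteq> {}"
    and deg: "\<And>v. v \<in> e \<Longrightarrow> vertex_degree E v = 1"
  shows "e = UNIV"
proof -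
  obtain x where x: "x \<in> e" using e(2) by blast
  have step: "w \<in> e" if "u \<in> e" "{u, w} \<in> E" for u w
  proof -
    have "card {e' \<in> E. u \<in> e'} = 1"
      using deg[OF \<open>u \<in> e\<close>] by (simp only: vertex_degree_def)
    then obtain f where f: "{e' \<in> E. u \<in> e'} = {f}"
      by (rule card_1_singletonE)
    have "e \<in> {e' \<in> E. u \<in> e'}" "{u, w} \<in> {e' \<in> E. u \<in> e'}"
      using that e(1) by simp_all
    then have "{u, w} = e"
      unfolding f by simp
    then show ?thesis by blast
  qed
  have "z \<in> e" for z
  proof -
    have "(x, z) \<in> {(x, y). {x, y} \<in> E}\<^sup>*"
      using conn by (simp add: connected_graph_def)
    then show ?thesis
      by (induction rule: rtrancl_induct) (use x step in auto)
  qed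
  then show ?thesis by blast
qed

text \<open>Each edge of the matching has an end that is not pendant, and different edges give different ends.
For two vertices this argument fails, and the bound rests on counting a single pendant vertex.\<close>

lemma matching_pendant_bound:
  fixes E :: "'v::finite set set"
  assumes tree: "is_tree E" and n: "CARD('v) \<ge> 2" and M: "M \<subseteq> E" "matching M"
  shows "card M + num_pendant E \<le> CARD('v)"
proof -
  have two: "2 * card M \<le> CARD('v)"
    using card_mono[of UNIV "\<Union>M"] by (simp add: matching_card_Union[OF M(2)])
  show ?thesis
  proof (cases "CARD('v) = 2")
    case True
    with two show ?thesis by (simp add: num_pendant_def)
  next
    case False
    let ?P = "{v. vertex_degree E v = 1}"
    have "\<exists>v\<in>e. v \<notin> ?P" if e: "e \<in> M" for e
    proof (rule ccontr)
      assume *: "\<not> (\<exists>v\<in>e. v \<notin> ?P)"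
      have card: "card e = 2" using e M(2) by (simp add: matching_def)
      have "e = UNIV"
        using tree * e M(1) card by (intro pendant_edge_is_component[of E]) (auto simp: is_tree_def)
      with card False show False by simp
    qed
    then obtain v where v: "\<And>e. e \<in> M \<Longrightarrow> v e \<in> e \<and> v e \<notin> ?P" by metis
    have "inj_on v M"
    proof (rule inj_onI)
      fix e f assume "e \<in> M" "f \<in> M" "v e = v f"
      then have "v e \<in> e \<inter> f" using v[of e] v[of f] by simp
      with \<open>e \<in> M\<close> \<open>f \<in> M\<close> M(2) show "e = f" unfolding matching_def by blast
    qed
    then have "card M = card (v ` M)" by (simp add: card_image)
    also have "\<dots> \<le> card (- ?P)" using v by (intro card_mono) auto
    also have "\<dots> = CARD('v) - card ?P" by (simp add: Compl_eq_Diff_UNIV card_Diff_subset)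
    finally show ?thesis
      using False card_mono[of UNIV ?P] by (simp add: num_pendant_def)
  qed
qed

section \<open>Edge ideals and the irrelevant ideal\<close>

lemma ideal_class_ringD:
  fixes J :: "'a::comm_ring_1 set"
  assumes "ideal J class_ring"
  shows "0 \<in> J" "a \<in> J \<Longrightarrow> b \<in> J \<Longrightarrow> a + b \<in> J" "a \<in> J \<Longrightarrow> f * a \<in> J"
    "a \<in> J \<Longrightarrow> - a \<in> J" "a \<in> J \<Longrightarrow> b \<in> J \<Longrightarrow> a - b \<in> J"
proof -
  interpret ideal J "class_ring" by fact
  show *: "a \<in> J \<Longrightarrow> f * a \<in> J" for a f
    using I_l_closed[of a f] by simp
  show plus: "a \<in> J \<Longrightarrow> b \<in> J \<Longrightarrow> a + b \<in> J" for a b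
    using a_closed[of a b] by simp
  show "0 \<in> J"
    using zero_closed by simp
  show minus: "a \<in> J \<Longrightarrow> - a \<in> J" for a
    using *[of a "- 1"] by simp
  show "a \<in> J \<Longrightarrow> b \<in> J \<Longrightarrow> a - b \<in> J"
    using plus[of a "- b"] minus by simp
qed

lemma ideal_class_ringI:
  fixes J :: "'a::comm_ring_1 set"
  assumes "0 \<in> J" "\<And>a b. a \<in> J \<Longrightarrow> b \<in> J \<Longrightarrow> a + b \<in> J" "\<And>f a. a \<in> J \<Longrightarrow> f * a \<in> J"
  shows "ideal J class_ring"
proof (rule idealI)
  show "ring (class_ring :: 'a ring)"
    by (rule VS_Connect.class_ring.ring_axioms)
  show "subgroup J (add_monoid (class_ring :: 'a ring))"
  proof (rule group.subgroupI)
    show "Group.group (add_monoid (class_ring :: 'a ring))"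
      using VS_Connect.class_ring.a_group by simp
    show "J \<noteq> {}" using assms(1) by blast
    fix a b assume a: "a \<in> J"
    have "- a \<in> J" using assms(3)[OF a, of "- 1"] by simp
    moreover have "inv\<^bsub>add_monoid (class_ring :: 'a ring)\<^esub> a = - a"
      using VS_Connect.class_ring_simps(8) unfolding a_inv_def by metis
    ultimately show "inv\<^bsub>add_monoid (class_ring :: 'a ring)\<^esub> a \<in> J" by simp
    show "a \<otimes>\<^bsub>add_monoid class_ring\<^esub> b \<in> J" if "b \<in> J"
      using assms(2)[OF a that] by simp
  qed simp
qed (use assms(3) in \<open>simp_all add: mult.commute\<close>)

lemma ideal_class_ring_sum:
  fixes J :: "'a::comm_ring_1 set"
  assumes "ideal J class_ring" "\<And>a. a \<in> A \<Longrightarrow> g a \<in> J"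
  shows "sum g A \<in> J"
  using assms(2)
  by (induction A rule: infinite_finite_induct)
    (simp_all add: ideal_class_ringD(1,2)[OF assms(1)])

lemma sf_ideal_is_ideal: "ideal (sf_ideal E :: ('v, 'k::field) mpoly set) class_ring"
  by (rule ideal_class_ringI) (simp_all add: sf_ideal_zero sf_ideal_add sf_ideal_mult)

lemma genideal_eqI:
  fixes J :: "'a::comm_ring_1 set"
  assumes "ideal J class_ring" "G \<subseteq> J" "\<And>J'. ideal J' class_ring \<Longrightarrow> G \<subseteq> J' \<Longrightarrow> J \<subseteq> J'"
  shows "Idl\<^bsub>class_ring\<^esub> G = J"
  using assms unfolding genideal_def by blast

text \<open>Each monomial of an element of \<open>sf_ideal E\<close> is a multiple of one of the generators.\<close>

lemma genideal_sf_ideal: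
  assumes fin: "\<And>e. e \<in> E \<Longrightarrow> finite e"
  shows "Idl\<^bsub>class_ring\<^esub> ((\<lambda>e. Poly_Mapping.single (sf_monom e) 1) ` E) =
    (sf_ideal E :: ('v, 'k::field) mpoly set)"
proof (rule genideal_eqI[OF sf_ideal_is_ideal])
  show "(\<lambda>e. Poly_Mapping.single (sf_monom e) 1) ` E \<subseteq> (sf_ideal E :: ('v, 'k) mpoly set)"
    using fin by (auto simp: sf_ideal_def keys_sf_monom)
  fix J :: "('v, 'k) mpoly set"
  assume J: "ideal J class_ring" and sub: "(\<lambda>e. Poly_Mapping.single (sf_monom e) 1) ` E \<subseteq> J"
  show "sf_ideal E \<subseteq> J"
  proof
    fix f :: "('v, 'k) mpoly" assume f: "f \<in> sf_ideal E"
    have monom: "Poly_Mapping.single m c \<in> J" if m: "m \<in> Poly_Mapping.keys f" for m c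
    proof -
      obtain e where e: "e \<in> E" "e \<subseteq> Poly_Mapping.keys m"
        using f m unfolding sf_ideal_def by blast
      have "m - sf_monom e + sf_monom e = m"
      proof (rule poly_mapping_eqI)
        fix v
        have "v \<in> e \<Longrightarrow> Poly_Mapping.lookup m v > 0"
          using e(2) by (auto simp: in_keys_iff)
        then show "Poly_Mapping.lookup (m - sf_monom e + sf_monom e) v = Poly_Mapping.lookup m v"
          using fin[OF e(1)] by (simp add: lookup_add lookup_minus lookup_sf_monom)
      qed
      then have "Poly_Mapping.single m c =
          Poly_Mapping.single (m - sf_monom e) c * Poly_Mapping.single (sf_monom e) 1"
        by (simp add: mult_single)
      moreover have "Poly_Mapping.single (sf_monom e) 1 \<in> J"
        using sub e(1) by blast
      ultimately show ?thesis
        using ideal_class_ringD(3)[OF J] by simp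
    qed
    have "(\<Sum>m\<in>Poly_Mapping.keys f. Poly_Mapping.single m (Poly_Mapping.lookup f m)) \<in> J"
      by (rule ideal_class_ring_sum[OF J]) (rule monom)
    then show "f \<in> J"
      by (simp only: sum_monomials)
  qed
qed

lemma edge_ideal_eq:
  assumes "\<And>e. e \<in> E \<Longrightarrow> card e = 2"
  shows "edge_ideal E = (sf_ideal E :: ('v, 'k::field) mpoly set)"
proof -
  have eq: "mvar x * mvar y = (Poly_Mapping.single (sf_monom {x, y}) 1 :: ('v, 'k) mpoly)"
    if "{x, y} \<in> E" for x y
  proof -
    have "x \<noteq> y" using assms[OF that] by auto
    then show ?thesis by (simp add: mvar_def mult_single sf_monom_def)
  qed
  have "{mvar x * mvar y | x y. {x, y} \<in> E} =
      (\<lambda>e. Poly_Mapping.single (sf_monom e) 1 :: ('v, 'k) mpoly) ` E" (is "?L = ?R")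
  proof
    show "?L \<subseteq> ?R"
    proof
      fix f assume "f \<in> ?L"
      then obtain x y where "f = mvar x * mvar y" "{x, y} \<in> E" by blast
      then show "f \<in> ?R" using eq[of x y] by (intro image_eqI[where x = "{x, y}"]) simp_all
    qed
    show "?R \<subseteq> ?L"
    proof
      fix f assume "f \<in> ?R"
      then obtain e where e: "e \<in> E" "f = Poly_Mapping.single (sf_monom e) 1" by blast
      then obtain x y where "e = {x, y}" using assms[OF e(1)] by (meson card_2_iff)
      then have "f = mvar x * mvar y" "{x, y} \<in> E"
        using e eq[of x y] by simp_all
      then show "f \<in> ?L" by (intro CollectI exI conjI)
    qed
  qed
  moreover have "finite e" if "e \<in> E" for e
    using assms[OF that] by (intro card_ge_0_finite) simp
  ultimately show ?thesis
    unfolding edge_ideal_def by (simp only: genideal_sf_ideal)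
qed

text \<open>The irrelevant ideal is the squarefree monomial ideal of the singletons, and a monomial has nonempty
support exactly when it is not 1.\<close>

lemma irrelevant_ideal_iff:
  "f \<in> (irrelevant_ideal :: ('v, 'k::field) mpoly set) \<longleftrightarrow> const_coeff f = 0"
proof -
  have "range mvar = (\<lambda>e. Poly_Mapping.single (sf_monom e) 1 :: ('v, 'k) mpoly) ` range (\<lambda>v. {v})"
    by (simp add: image_image mvar_def sf_monom_def)
  moreover have "Idl\<^bsub>class_ring\<^esub> \<dots> = (sf_ideal (range (\<lambda>v. {v})) :: ('v, 'k) mpoly set)"
    by (rule genideal_sf_ideal) auto
  ultimately have "irrelevant_ideal = (sf_ideal (range (\<lambda>v. {v})) :: ('v, 'k) mpoly set)"
    unfolding irrelevant_ideal_def by (simp only:)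
  moreover have "(\<exists>e\<in>range (\<lambda>v. {v}). e \<subseteq> Poly_Mapping.keys m) \<longleftrightarrow> m \<noteq> 0" for m :: "'v \<Rightarrow>\<^sub>0 nat"
  proof -
    have "(\<exists>e\<in>range (\<lambda>v. {v}). e \<subseteq> K) \<longleftrightarrow> K \<noteq> {}" for K :: "'v set"
      by blast
    then show ?thesis
      by (simp only: keys_eq_empty)
  qed
  ultimately have "f \<in> irrelevant_ideal \<longleftrightarrow> 0 \<notin> Poly_Mapping.keys f"
    by (simp only: sf_ideal_def mem_Collect_eq) blast
  then show ?thesis
    by (simp add: in_keys_iff)
qed

section \<open>Quotient modules\<close>

abbreviation cls :: "('v, 'k::field) mpoly set \<Rightarrow> ('v, 'k) mpoly \<Rightarrow> ('v, 'k) mpoly set" where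
  "cls I f \<equiv> I +>\<^bsub>class_ring\<^esub> f"

lemma cls_eq_zero_iff:
  assumes "ideal I class_ring"
  shows "cls I f = I \<longleftrightarrow> f \<in> I"
proof
  assume "cls I f = I"
  moreover have "f \<in> cls I f"
    using ideal_class_ringD(1)[OF assms] by (force simp: a_r_coset_def r_coset_def)
  ultimately show "f \<in> I" by simp
next
  assume f: "f \<in> I"
  show "cls I f = I"
  proof
    show "cls I f \<subseteq> I"
      using ideal_class_ringD(2)[OF assms] f by (auto simp: a_r_coset_def r_coset_def)
    show "I \<subseteq> cls I f"
    proof
      fix g assume "g \<in> I"
      then have "g - f \<in> I" "g = (g - f) + f"
        using ideal_class_ringD(5)[OF assms] f by simp_all
      then show "g \<in> cls I f"
        by (auto simp: a_r_coset_def r_coset_def intro: bexI[where x = "g - f"])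
    qed
  qed
qed

lemma quotient_module_simps:
  assumes I: "ideal I (class_ring :: ('v, 'k::field) mpoly ring)"
  shows "carrier (quotient_module I) = range (cls I)"
    and "\<zero>\<^bsub>quotient_module I\<^esub> = I"
    and "cls I f \<oplus>\<^bsub>quotient_module I\<^esub> cls I g = cls I (f + g)"
    and "f \<odot>\<^bsub>quotient_module I\<^esub> cls I g = cls I (f * g)"
    and "component (quotient_module I) d = cls I ` homogeneous_part d"
    and "abelian_monoid (quotient_module I)"
proof -
  interpret ideal I "class_ring :: ('v, 'k) mpoly ring" by fact
  interpret h: ring_hom_ring "class_ring :: ('v, 'k) mpoly ring" "class_ring Quot I" "cls I"
    by (rule rcos_ring_hom_ring)
  show "carrier (quotient_module I) = range (cls I)"
    by (auto simp: quotient_module_def ring.defs FactRing_def A_RCOSETS_def' a_r_coset_def r_coset_def)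
  show "\<zero>\<^bsub>quotient_module I\<^esub> = I"
    by (simp add: quotient_module_def ring.defs FactRing_def)
  show "cls I f \<oplus>\<^bsub>quotient_module I\<^esub> cls I g = cls I (f + g)"
    using h.hom_add[of f g] by (simp add: quotient_module_def ring.defs)
  show "f \<odot>\<^bsub>quotient_module I\<^esub> cls I g = cls I (f * g)"
    using h.hom_mult[of f g] by (simp add: quotient_module_def ring.defs)
  show "component (quotient_module I) d = cls I ` homogeneous_part d"
    by (simp add: quotient_module_def ring.defs)
  show "abelian_monoid (quotient_module I)"
    by (rule abelian_monoidI)
      (simp_all add: quotient_module_def ring.defs h.S.a_assoc, simp add: h.S.a_comm)
qed

lemma quotient_finsum:
  assumes I: "ideal I (class_ring :: ('v, 'k::field) mpoly ring)"
  shows "(\<Oplus>\<^bsub>quotient_module I\<^esub>a\<in>{..<n::nat}. cls I (g a)) = cls I (\<Sum>a<n. g a)"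
proof (induction n)
  case 0
  have "cls I 0 = I"
    using cls_eq_zero_iff[OF I] ideal_class_ringD(1)[OF I] by blast
  then show ?case
    using abelian_monoid.finsum_empty[OF quotient_module_simps(6)[OF I]]
    by (simp add: quotient_module_simps(2)[OF I])
next
  case (Suc n)
  have "(\<Oplus>\<^bsub>quotient_module I\<^esub>a\<in>insert n {..<n}. cls I (g a)) =
      cls I (g n) \<oplus>\<^bsub>quotient_module I\<^esub> (\<Oplus>\<^bsub>quotient_module I\<^esub>a\<in>{..<n}. cls I (g a))"
    by (rule abelian_monoid.finsum_insert[OF quotient_module_simps(6)[OF I]])
      (simp_all add: quotient_module_simps(1)[OF I])
  then show ?case
    by (simp only: Suc lessThan_Suc quotient_module_simps(3)[OF I] sum.insert finite_lessThan
        lessThan_iff less_irrefl simp_thms if_False)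
qed

lemma aug_map_quotient:
  assumes I: "ideal I (class_ring :: ('v, 'k::field) mpoly ring)"
    and "\<And>a. a < free_rank F 0 \<Longrightarrow> aug F ! a = cls I (f a)"
  shows "aug_map (quotient_module I) F v = cls I (\<Sum>a<free_rank F 0. v $ a * f a)"
proof -
  have "aug_map (quotient_module I) F v =
      (\<Oplus>\<^bsub>quotient_module I\<^esub>a\<in>{..<free_rank F 0}. cls I (v $ a * f a))"
    unfolding aug_map_def
    by (rule abelian_monoid.finsum_cong'[OF quotient_module_simps(6)[OF I]])
      (use assms(2) in \<open>simp_all add: quotient_module_simps(1,4)[OF I]\<close>)
  then show ?thesis
    by (simp add: quotient_finsum[OF I])
qed

section \<open>Matrices and vectors\<close>

text \<open>The translation between the matrix description of complexes and the vectors used above.\<close>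

definition fvec_of :: "('v, 'k::field) mpoly vec \<Rightarrow> ('v, 'k) fvec" where
  "fvec_of w = (\<lambda>i. if i < dim_vec w then w $ i else 0)"

definition columns :: "('v, 'k::field) mpoly mat \<Rightarrow> ('v, 'k) fvec list" where
  "columns D = map (\<lambda>b i. if i < dim_row D then D $$ (i, b) else 0) [0..<dim_col D]"

lemma length_columns [simp]: "length (columns D) = dim_col D"
  by (simp add: columns_def)

lemma columns_nth:
  "b < dim_col D \<Longrightarrow> (columns D ! b) i = (if i < dim_row D then D $$ (i, b) else 0)"
  by (simp add: columns_def)

lemma inj_on_fvec_of: "inj_on fvec_of (carrier_vec n :: ('v, 'k::field) mpoly vec set)"
proof (rule inj_onI)
  fix u w :: "('v, 'k) mpoly vec"
  assume uw: "u \<in> carrier_vec n" "w \<in> carrier_vec n" and eq: "fvec_of u = fvec_of w"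
  show "u = w"
  proof (rule eq_vecI)
    fix i assume "i < dim_vec w"
    then show "u $ i = w $ i"
      using fun_cong[OF eq, of i] uw by (simp add: fvec_of_def)
  qed (use uw in simp)
qed

lemma fvec_of_mult:
  assumes "dim_vec w = dim_col D"
  shows "fvec_of (D *\<^sub>v w) = lincomb (columns D) (fvec_of w)"
proof
  fix i
  show "fvec_of (D *\<^sub>v w) i = lincomb (columns D) (fvec_of w) i"
  proof (cases "i < dim_row D")
    case True
    have "lincomb (columns D) (fvec_of w) i = (\<Sum>b<dim_col D. w $ b * D $$ (i, b))"
      unfolding lincomb_def length_columns
      by (rule sum.cong) (use True assms in \<open>simp_all add: columns_nth fvec_of_def\<close>)
    also have "\<dots> = (\<Sum>b = 0..<dim_vec w. row D i $ b * w $ b)"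
      unfolding assms using True
      by (intro sum.cong) (auto simp: mult.commute)
    also have "\<dots> = (D *\<^sub>v w) $ i"
      using True by (simp add: scalar_prod_def)
    finally show ?thesis
      using True by (simp add: fvec_of_def)
  next
    case False
    have "lincomb (columns D) (fvec_of w) i = (\<Sum>b<dim_col D. 0)"
      unfolding lincomb_def length_columns
      by (rule sum.cong) (use False in \<open>simp_all add: columns_nth\<close>)
    then show ?thesis using False by (simp add: fvec_of_def)
  qed
qed

lemma fvec_of_vec: "fvec_of (vec n c) = trunc n c"
  by (auto simp: fvec_of_def trunc_def)

lemma fvec_of_zero: "fvec_of (0\<^sub>v n) = 0"
  by (auto simp: fvec_of_def)

lemma fvec_of_range:
  "fvec_of ` (\<lambda>w. D *\<^sub>v w) ` carrier_vec (dim_col D) = range (lincomb (columns D))"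
proof
  show "fvec_of ` (\<lambda>w. D *\<^sub>v w) ` carrier_vec (dim_col D) \<subseteq> range (lincomb (columns D))"
  proof
    fix x assume "x \<in> fvec_of ` (\<lambda>w. D *\<^sub>v w) ` carrier_vec (dim_col D)"
    then obtain w where w: "w \<in> carrier_vec (dim_col D)" "x = fvec_of (D *\<^sub>v w)"
      by blast
    then show "x \<in> range (lincomb (columns D))"
      by (simp add: fvec_of_mult)
  qed
  show "range (lincomb (columns D)) \<subseteq> fvec_of ` (\<lambda>w. D *\<^sub>v w) ` carrier_vec (dim_col D)"
  proof
    fix x assume "x \<in> range (lincomb (columns D))"
    then obtain c where "x = lincomb (columns D) c" by blast
    then have "x = fvec_of (D *\<^sub>v vec (dim_col D) c)"
      using lincomb_trunc[of "columns D" c] by (simp add: fvec_of_mult fvec_of_vec)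
    moreover have "D *\<^sub>v vec (dim_col D) c \<in> (\<lambda>w. D *\<^sub>v w) ` carrier_vec (dim_col D)"
      by (rule imageI) (simp add: carrier_vecI)
    ultimately show "x \<in> fvec_of ` (\<lambda>w. D *\<^sub>v w) ` carrier_vec (dim_col D)"
      by (simp only: imageI)
  qed
qed

lemma fvec_of_kernel: "fvec_of ` mat_kernel D = syz (columns D)"
proof
  show "fvec_of ` mat_kernel D \<subseteq> syz (columns D)"
  proof
    fix x assume "x \<in> fvec_of ` mat_kernel D"
    then obtain w where w: "w \<in> carrier_vec (dim_col D)" "D *\<^sub>v w = 0\<^sub>v (dim_row D)" "x = fvec_of w"
      unfolding mat_kernel_def by blast
    have "lincomb (columns D) x = 0"
      using fvec_of_mult[of w D] w(1) by (simp add: w(2,3) fvec_of_zero)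
    then show "x \<in> syz (columns D)"
      using w(1) by (simp add: syz_def) (simp add: w(3) fvec_of_def)
  qed
  show "syz (columns D) \<subseteq> fvec_of ` mat_kernel D"
  proof
    fix x assume x: "x \<in> syz (columns D)"
    let ?w = "vec (dim_col D) x"
    have x': "x = fvec_of ?w"
    proof
      fix i show "x i = fvec_of ?w i"
        using syzD(2)[OF x, of i] by (simp add: fvec_of_def)
    qed
    have "fvec_of (D *\<^sub>v ?w) = fvec_of (0\<^sub>v (dim_row D))"
      using syzD(1)[OF x] fvec_of_mult[of ?w D] by (simp add: x'[symmetric] fvec_of_zero)
    then have "D *\<^sub>v ?w = 0\<^sub>v (dim_row D)"
    proof (rule inj_onD[OF inj_on_fvec_of])
      show "D *\<^sub>v ?w \<in> carrier_vec (dim_row D)"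
        by (rule carrier_vecI) simp
    qed (rule zero_carrier_vec)
    then have "?w \<in> mat_kernel D"
      unfolding mat_kernel_def mem_Collect_eq by (rule conjI[OF vec_carrier])
    then have "fvec_of ?w \<in> fvec_of ` mat_kernel D"
      by (rule imageI)
    with x'[symmetric] show "x \<in> fvec_of ` mat_kernel D"
      by (simp only:)
  qed
qed

section \<open>Minimal resolutions of quotients by homogeneous ideals\<close>

lemma minimal_resolutionD:
  assumes "minimal_graded_free_resolution M F"
  shows "graded_free_data M F"
    and "aug_map M F ` carrier_vec (free_rank F 0) = carrier M"
    and "{v \<in> carrier_vec (free_rank F 0). aug_map M F v = \<zero>\<^bsub>M\<^esub>} =
       (\<lambda>w. diff F 0 *\<^sub>v w) ` carrier_vec (free_rank F 1)"
    and "\<forall>i. mat_kernel (diff F i) =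
       (\<lambda>w. diff F (Suc i) *\<^sub>v w) ` carrier_vec (free_rank F (Suc (Suc i)))"
    and "\<forall>i. elements_mat (diff F i) \<subseteq> irrelevant_ideal"
proof -
  note F = assms[unfolded minimal_graded_free_resolution_def graded_free_resolution_def]
  show "graded_free_data M F"
    and "aug_map M F ` carrier_vec (free_rank F 0) = carrier M"
    and "{v \<in> carrier_vec (free_rank F 0). aug_map M F v = \<zero>\<^bsub>M\<^esub>} =
       (\<lambda>w. diff F 0 *\<^sub>v w) ` carrier_vec (free_rank F 1)"
    and "\<forall>i. mat_kernel (diff F i) =
       (\<lambda>w. diff F (Suc i) *\<^sub>v w) ` carrier_vec (free_rank F (Suc (Suc i)))"
    and "\<forall>i. elements_mat (diff F i) \<subseteq> irrelevant_ideal"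
    by (insert F, elim conjE, assumption)+
qed

lemma graded_free_dataD:
  assumes "graded_free_data M F"
  shows "a < free_rank F 0 \<Longrightarrow> aug F ! a \<in> component M (shifts F 0 ! a)"
    and "diff F i \<in> carrier_mat (free_rank F i) (free_rank F (Suc i))"
    and "a < free_rank F i \<Longrightarrow> b < free_rank F (Suc i) \<Longrightarrow>
      diff F i $$ (a, b) \<in> homogeneous_part (shifts F (Suc i) ! b - shifts F i ! a)"
  using assms unfolding graded_free_data_def by simp_all

lemma minimal_differential_const:
  assumes F: "minimal_graded_free_resolution M F" and "a < free_rank F i" "b < free_rank F (Suc i)"
  shows "const_coeff (diff F i $$ (a, b)) = 0"
proof -
  have "diff F i $$ (a, b) \<in> elements_mat (diff F i)"
    by (rule elements_matI[OF graded_free_dataD(2)[OF minimal_resolutionD(1)[OF F]] assms(2,3) refl])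
  then have "diff F i $$ (a, b) \<in> irrelevant_ideal"
    by (rule subsetD[OF spec[OF minimal_resolutionD(5)[OF F]]])
  then show ?thesis
    by (simp only: irrelevant_ideal_iff)
qed

lemma minimal_boundary_const:
  assumes F: "minimal_graded_free_resolution M F" and w: "w \<in> carrier_vec (free_rank F (Suc i))"
    and a: "a < free_rank F i"
  shows "const_coeff ((diff F i *\<^sub>v w) $ a) = 0"
proof -
  have "diff F i \<in> carrier_mat (free_rank F i) (free_rank F (Suc i))"
    by (rule graded_free_dataD(2)[OF minimal_resolutionD(1)[OF F]])
  then have "(diff F i *\<^sub>v w) $ a = (\<Sum>b = 0..<free_rank F (Suc i). diff F i $$ (a, b) * w $ b)"
    using a w by (simp add: scalar_prod_def)
  then show ?thesis
    using minimal_differential_const[OF F a]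
    by (simp add: lookup_sum const_coeff_mult_zero)
qed

text \<open>The hypothesis on constant coefficients places \<open>I\<close> inside the irrelevant ideal.\<close>

locale proper_ideal =
  fixes I :: "('v, 'k::field) mpoly set"
  assumes is_ideal: "ideal I class_ring" and proper: "f \<in> I \<Longrightarrow> const_coeff f = 0"
begin

lemma one_notin: "1 \<notin> I"
  using proper[of 1] by (auto simp: lookup_one)

text \<open>The module \<open>S/I\<close> is generated by the class of 1, so minimality leaves no choice for the first step
of a resolution beyond a nonzero scalar.\<close>

lemma minimal_augmentation:
  assumes F: "minimal_graded_free_resolution (quotient_module I) F"
  shows "shifts F 0 = [0]"
    and "{v \<in> carrier_vec (free_rank F 0). aug_map (quotient_module I) F v = \<zero>\<^bsub>quotient_module I\<^esub>} =
      {v \<in> carrier_vec 1. v $ 0 \<in> I}"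
proof -
  let ?M = "quotient_module I" and ?n = "free_rank F 0"
  have data: "graded_free_data ?M F"
    and surj: "aug_map ?M F ` carrier_vec ?n = carrier ?M"
    and ker: "{v \<in> carrier_vec ?n. aug_map ?M F v = \<zero>\<^bsub>?M\<^esub>} =
       (\<lambda>w. diff F 0 *\<^sub>v w) ` carrier_vec (free_rank F 1)"
    by (rule minimal_resolutionD[OF F])+
  have "\<exists>f. f \<in> homogeneous_part (shifts F 0 ! a) \<and> aug F ! a = cls I f" if "a < ?n" for a
    using graded_free_dataD(1)[OF data that] unfolding quotient_module_simps(5)[OF is_ideal] image_iff
    by blast
  then obtain f where f: "\<And>a. a < ?n \<Longrightarrow> f a \<in> homogeneous_part (shifts F 0 ! a)"
    and augf: "\<And>a. a < ?n \<Longrightarrow> aug F ! a = cls I (f a)"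
    by metis
  have aug: "aug_map ?M F v = cls I (\<Sum>a<?n. v $ a * f a)" for v
    using aug_map_quotient[OF is_ideal, of F f] augf by simp
  have zero: "\<zero>\<^bsub>?M\<^esub> = I" by (rule quotient_module_simps(2)[OF is_ideal])
  have const: "const_coeff (w a) = 0" if "(\<Sum>a<?n. w a * f a) \<in> I" "a < ?n" for w a
  proof -
    have "(\<Sum>a<?n. vec ?n w $ a * f a) \<in> I"
      using that(1) by simp
    then have "vec ?n w \<in> (\<lambda>w. diff F 0 *\<^sub>v w) ` carrier_vec (free_rank F 1)"
      unfolding ker[symmetric] by (simp add: aug zero cls_eq_zero_iff[OF is_ideal])
    then obtain u where "u \<in> carrier_vec (free_rank F (Suc 0))" "vec ?n w = diff F 0 *\<^sub>v u"
      by auto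
    then have "const_coeff (vec ?n w $ a) = 0"
      using minimal_boundary_const[OF F _ that(2)] by simp
    then show ?thesis using that(2) by simp
  qed
  have sum_basis: "(\<Sum>b<?n. (if b = a then g else 0) * f b) = g * f a" if "a < ?n" for a g
    using that by (simp add: if_distrib[of "\<lambda>x. x * _"] cong: if_cong)
  have fnz: "f a \<notin> I" if a: "a < ?n" for a
  proof
    assume "f a \<in> I"
    then have "const_coeff (if a = a then 1 else 0 :: ('v, 'k) mpoly) = 0"
      using sum_basis[OF a, of 1] a by (intro const[of "\<lambda>b. if b = a then 1 else 0"]) simp_all
    then show False by simp
  qed
  have "cls I 1 \<in> aug_map ?M F ` carrier_vec ?n"
    unfolding surj by (simp add: quotient_module_simps(1)[OF is_ideal])
  then obtain v where v: "cls I 1 = cls I (\<Sum>a<?n. v $ a * f a)"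
    unfolding aug by blast
  have "1 \<in> cls I 1"
    using ideal_class_ringD(1)[OF is_ideal] by (force simp: a_r_coset_def r_coset_def)
  then obtain i where "i \<in> I" "1 = i + (\<Sum>a<?n. v $ a * f a)"
    unfolding v by (auto simp: a_r_coset_def r_coset_def)
  then have v1: "1 - (\<Sum>a<?n. v $ a * f a) \<in> I" by (metis add_diff_cancel_right')
  have s0: "shifts F 0 ! a = 0" if a: "a < ?n" for a
  proof (rule ccontr)
    assume "shifts F 0 ! a \<noteq> 0"
    then have c: "const_coeff (f a) = 0"
      by (rule const_coeff_homogeneous[OF f[OF a]])
    \<comment> \<open>Since 1 is a combination of the \<open>f b\<close> modulo \<open>I\<close>, so is \<open>f a\<close>, with coefficients in the
      irrelevant ideal; this contradicts minimality.\<close>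
    define w where "w b = (if b = a then 1 else 0) - f a * v $ b" for b
    have "(\<Sum>b<?n. w b * f b) = (\<Sum>b<?n. (if b = a then 1 else 0) * f b) - (\<Sum>b<?n. f a * v $ b * f b)"
      by (simp only: w_def left_diff_distrib sum_subtractf)
    also have "\<dots> = f a * (1 - (\<Sum>b<?n. v $ b * f b))"
      unfolding sum_basis[OF a] by (simp add: right_diff_distrib sum_distrib_left mult.assoc)
    finally have "(\<Sum>b<?n. w b * f b) \<in> I"
      using ideal_class_ringD(3)[OF is_ideal v1] by simp
    then have "const_coeff (w a) = 0" using a by (rule const)
    then show False
      by (simp add: w_def lookup_minus const_coeff_mult_zero[OF c])
  qed
  have fc: "f a = const_poly (const_coeff (f a))" if "a < ?n" for a
    using f[OF that] s0[OF that] by (intro homogeneous_0) simp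
  have fc0: "const_coeff (f a) \<noteq> 0" if "a < ?n" for a
    using fc[OF that] fnz[OF that] ideal_class_ringD(1)[OF is_ideal] by (auto simp: const_poly_def)
  have "?n \<noteq> 0"
    using v1 one_notin by (intro notI) simp
  moreover have "\<not> 1 < ?n"
  proof
    assume n: "1 < ?n"
    \<comment> \<open>Two nonzero scalars have a syzygy with nonzero constant coefficients.\<close>
    define w where "w b = (if b = 0 then f 1 else 0) - (if b = 1 then f 0 else 0)" for b :: nat
    have "(\<Sum>b<?n. w b * f b) = (\<Sum>b<?n. (if b = 0 then f 1 else 0) * f b) - (\<Sum>b<?n. (if b = 1 then f 0 else 0) * f b)"
      by (simp only: w_def left_diff_distrib sum_subtractf)
    also have "\<dots> = 0"
      using n by (subst (1 2) sum_basis) simp_all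
    finally have "const_coeff (w 0) = 0"
      using n ideal_class_ringD(1)[OF is_ideal] by (intro const) simp_all
    then show False
      using fc0[OF n] by (simp add: w_def)
  qed
  ultimately have n1: "?n = 1" by linarith
  then show "shifts F 0 = [0]"
    using s0[of 0] by (cases "shifts F 0") (auto simp: free_rank_def)
  have "x * f 0 \<in> I \<longleftrightarrow> x \<in> I" for x
  proof
    assume "x * f 0 \<in> I"
    then have "const_poly (1 / const_coeff (f 0)) * (x * f 0) \<in> I"
      by (rule ideal_class_ringD(3)[OF is_ideal])
    also have "const_poly (1 / const_coeff (f 0)) * (x * f 0) =
        x * (const_poly (1 / const_coeff (f 0)) * const_poly (const_coeff (f 0)))"
      using fc[of 0] n1 by (simp add: mult_ac)
    also have "\<dots> = x"
      using fc0[of 0] n1 by (simp add: const_poly_mult const_poly_1)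
    finally show "x \<in> I" .
  next
    assume "x \<in> I"
    then show "x * f 0 \<in> I"
      using ideal_class_ringD(3)[OF is_ideal, of x "f 0"] by (simp add: mult.commute)
  qed
  then show "{v \<in> carrier_vec ?n. aug_map ?M F v = \<zero>\<^bsub>?M\<^esub>} = {v \<in> carrier_vec 1. v $ 0 \<in> I}"
    unfolding aug zero cls_eq_zero_iff[OF is_ideal] n1 by simp
qed

lemma fvec_of_ideal: "fvec_of ` {v \<in> carrier_vec 1. v $ 0 \<in> I} = ideal_vecs I"
proof
  show "fvec_of ` {v \<in> carrier_vec 1. v $ 0 \<in> I} \<subseteq> ideal_vecs I"
    by (auto simp: fvec_of_def ideal_vecs_def)
  show "ideal_vecs I \<subseteq> fvec_of ` {v \<in> carrier_vec 1. v $ 0 \<in> I}"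
  proof
    fix x assume x: "x \<in> ideal_vecs I"
    then have x': "x = fvec_of (vec 1 x)"
      by (auto simp: fvec_of_def ideal_vecs_def)
    have "vec 1 x \<in> {v \<in> carrier_vec 1. v $ 0 \<in> I}"
      using x unfolding mem_Collect_eq by (intro conjI vec_carrier) (simp add: ideal_vecs_def)
    from imageI[OF this, of fvec_of] show "x \<in> fvec_of ` {v \<in> carrier_vec 1. v $ 0 \<in> I}"
      by (simp only: x'[symmetric])
  qed
qed

text \<open>The submodule of the free module in step \<open>i\<close> that the differential from step \<open>i + 1\<close> has to generate.\<close>

definition syzygy :: "(('v, 'k) mpoly, ('v, 'k) mpoly set) free_complex \<Rightarrow> nat \<Rightarrow> ('v, 'k) fvec set" where
  "syzygy F i = (case i of 0 \<Rightarrow> ideal_vecs I | Suc j \<Rightarrow> syz (columns (diff F j)))"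

lemma minimal_resolution_gens:
  assumes F: "minimal_graded_free_resolution (quotient_module I) F"
  shows "hom_gens (shifts F i) (syzygy F i) (columns (diff F i)) (shifts F (Suc i))"
    and "minimal_gens (columns (diff F i))"
proof -
  have data: "graded_free_data (quotient_module I) F"
    and ker0: "{v \<in> carrier_vec (free_rank F 0). aug_map (quotient_module I) F v = \<zero>\<^bsub>quotient_module I\<^esub>} =
       (\<lambda>w. diff F 0 *\<^sub>v w) ` carrier_vec (free_rank F 1)"
    by (rule minimal_resolutionD[OF F])+
  have ker: "mat_kernel (diff F i) =
       (\<lambda>w. diff F (Suc i) *\<^sub>v w) ` carrier_vec (free_rank F (Suc (Suc i)))" for i
    by (rule spec[OF minimal_resolutionD(4)[OF F]])
  have D: "diff F i \<in> carrier_mat (free_rank F i) (free_rank F (Suc i))" for i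
    by (rule graded_free_dataD(2)[OF data])
  have dims: "dim_row (diff F i) = length (shifts F i)" "dim_col (diff F i) = length (shifts F (Suc i))" for i
    using D[of i] by (simp_all add: free_rank_def)
  have range: "syzygy F i = range (lincomb (columns (diff F i)))" for i
  proof (cases i)
    case 0
    have "range (lincomb (columns (diff F 0))) =
        fvec_of ` (\<lambda>w. diff F 0 *\<^sub>v w) ` carrier_vec (free_rank F 1)"
      using fvec_of_range[of "diff F 0"] dims(2)[of 0] by (simp add: free_rank_def)
    also have "\<dots> = ideal_vecs I"
      unfolding ker0[symmetric] minimal_augmentation(2)[OF F] by (rule fvec_of_ideal)
    finally show ?thesis by (simp add: 0 syzygy_def)
  next
    case (Suc j)
    have "range (lincomb (columns (diff F (Suc j)))) = fvec_of ` mat_kernel (diff F j)"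
      using fvec_of_range[of "diff F (Suc j)"] dims(2)[of "Suc j"] ker[of j] by (simp add: free_rank_def)
    then show ?thesis by (simp add: Suc syzygy_def fvec_of_kernel)
  qed
  show "hom_gens (shifts F i) (syzygy F i) (columns (diff F i)) (shifts F (Suc i))"
    unfolding hom_gens_def
  proof (intro conjI allI impI range)
    show "length (columns (diff F i)) = length (shifts F (Suc i))"
      by (simp add: dims)
    fix b assume b: "b < length (columns (diff F i))"
    show "hom_vec (shifts F i) (shifts F (Suc i) ! b) (columns (diff F i) ! b)"
      unfolding hom_vec_def
    proof (intro conjI allI)
      show "columns (diff F i) ! b \<in> free_module (shifts F i)"
        using b by (simp add: free_module_def columns_nth dims)
      fix a
      have "diff F i $$ (a, b) \<in> homogeneous_part (shifts F (Suc i) ! b - shifts F i ! a)"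
        if "a < length (shifts F i)"
        using graded_free_dataD(3)[OF data, of a i b] that b dims by (simp add: free_rank_def)
      then show "(columns (diff F i) ! b) a \<in> homogeneous_part (shifts F (Suc i) ! b - shifts F i ! a)"
        using b by (simp add: columns_nth dims)
    qed
  qed
  have "const_coeff (c a) = 0" if "c \<in> syz (columns (diff F i))" for c a
  proof -
    have "c \<in> syzygy F (Suc i)"
      using that by (simp add: syzygy_def)
    then obtain d where d: "c = lincomb (columns (diff F (Suc i))) d"
      unfolding range by blast
    have "const_coeff (d b * (columns (diff F (Suc i)) ! b) a) = 0"
      if b: "b < dim_col (diff F (Suc i))" for b
    proof (cases "a < dim_row (diff F (Suc i))")
      case True
      then have "const_coeff (diff F (Suc i) $$ (a, b)) = 0"
        using b dims by (intro minimal_differential_const[OF F]) (simp_all add: free_rank_def)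
      then show ?thesis
        using b True const_coeff_mult_zero[of "diff F (Suc i) $$ (a, b)" "d b"]
        by (simp add: columns_nth mult.commute)
    qed (use b in \<open>simp add: columns_nth\<close>)
    then show ?thesis
      by (simp add: d lincomb_def lookup_sum)
  qed
  then show "minimal_gens (columns (diff F i))"
    unfolding minimal_gens_def by blast
qed

lemma minimal_resolution_upper:
  assumes F: "minimal_graded_free_resolution (quotient_module I) F"
    and reg: "reg_le (r + 1) [0] (ideal_vecs I)" and r: "0 \<le> r"
    and j: "j \<in> set (shifts F i)"
  shows "j - int i \<le> r"
proof -
  have regs: "reg_le (r + 1 + int i) (shifts F i) (syzygy F i)" for i
  proof (induction i)
    case 0
    show "reg_le (r + 1 + int 0) (shifts F 0) (syzygy F 0)"
      using reg by (simp add: syzygy_def minimal_augmentation(1)[OF F])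
  next
    case (Suc i)
    have "reg_le (r + 1 + int i + 1) (shifts F (Suc i)) (syz (columns (diff F i)))"
      by (rule reg_le_minimal_gens(2)[OF _ minimal_resolution_gens[OF F]]) (rule Suc.IH)
    then show "reg_le (r + 1 + int (Suc i)) (shifts F (Suc i)) (syzygy F (Suc i))"
      by (simp add: syzygy_def add_ac)
  qed
  show ?thesis
  proof (cases i)
    case 0
    then show ?thesis using j r by (simp add: minimal_augmentation(1)[OF F])
  next
    case (Suc i')
    have "j \<le> r + 1 + int i'"
      using reg_le_minimal_gens(1)[OF regs minimal_resolution_gens[OF F]] j Suc by blast
    then show ?thesis using Suc by simp
  qed
qed

text \<open>Every column of a minimal differential is nonzero and its entries have positive degree, so the
shifts increase in each step. With the upper bound, the set of differences whose maximum is the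
regularity is therefore finite.\<close>

lemma minimal_resolution_lower:
  assumes F: "minimal_graded_free_resolution (quotient_module I) F"
    and "j \<in> set (shifts F i)"
  shows "int i \<le> j"
  using assms(2)
proof (induction i arbitrary: j)
  case 0
  then show "int 0 \<le> j" by (simp add: minimal_augmentation(1)[OF F])
next
  case (Suc i)
  let ?cs = "columns (diff F i)"
  note gens = minimal_resolution_gens[OF F, of i]
  obtain b where b: "b < length (shifts F (Suc i))" "j = shifts F (Suc i) ! b"
    using Suc.prems by (metis in_set_conv_nth)
  have len: "length ?cs = length (shifts F (Suc i))"
    using gens(1) by (simp only: hom_gens_def)
  have hom: "hom_vec (shifts F i) j (?cs ! b)"
    using gens(1) b len by (simp add: hom_gens_def)
  have "?cs ! b \<noteq> 0"
  proof
    let ?e = "basis b :: ('v, 'k) fvec"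
    assume "?cs ! b = 0"
    then have "lincomb ?cs ?e = 0"
      using lincomb_basis[of b ?cs] b len by simp
    then have "trunc (length ?cs) ?e \<in> syz ?cs"
      by (rule trunc_syz)
    from minimal_gensD[OF gens(2) this, of b]
    have "const_coeff (trunc (length ?cs) ?e b) = 0" .
    then show False
      using b len by (simp add: trunc_def basis_def)
  qed
  then obtain a where a: "(?cs ! b) a \<noteq> 0"
    by (auto simp: fun_eq_iff)
  then have a': "a < length (shifts F i)"
    using hom by (auto simp: hom_vec_def free_module_def not_less[symmetric])
  have "shifts F i ! a < j"
  proof (rule ccontr)
    assume "\<not> shifts F i ! a < j"
    moreover have e: "(?cs ! b) a \<in> homogeneous_part (j - shifts F i ! a)"
      using hom by (simp add: hom_vec_def)
    ultimately have "j = shifts F i ! a"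
      using a homogeneous_neg[OF e] by fastforce
    then have c: "(?cs ! b) a = const_poly (const_coeff ((?cs ! b) a))"
      using e by (intro homogeneous_0) simp
    have "dim_row (diff F i) = length (shifts F i)" "dim_col (diff F i) = length (shifts F (Suc i))"
      using graded_free_dataD(2)[OF minimal_resolutionD(1)[OF F], of i] by (simp_all add: free_rank_def)
    then have "const_coeff ((?cs ! b) a) = 0"
      using minimal_differential_const[OF F, of a i b] a' b by (simp add: columns_nth free_rank_def)
    then show False
      using c a by (simp add: const_poly_def)
  qed
  moreover have "int i \<le> shifts F i ! a"
    using Suc.IH[of "shifts F i ! a"] a' by simp
  ultimately show "int (Suc i) \<le> j" by simp
qed

text \<open>The bound on the shifts provides finite generation of all syzygy modules that arise, so minimal
generators can be chosen step after step.\<close>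

lemma minimal_resolution_exists:
  assumes reg: "reg_le r [0] (ideal_vecs I)"
  shows "\<exists>F. minimal_graded_free_resolution (quotient_module I) F"
proof -
  \<comment> \<open>A state consists of the degrees \<open>s\<close> of a free module, a submodule \<open>N\<close>, minimal generators \<open>hs\<close>
    of \<open>N\<close> and their degrees \<open>us\<close>; the submodule of the next state is \<open>syz hs\<close>.\<close>
  define P where "P n = (\<lambda>(s, N, hs, us). (\<exists>\<rho>. reg_le \<rho> s N) \<and> hom_gens s N hs us \<and>
    minimal_gens (hs :: ('v, 'k) fvec list) \<and> (n = 0 \<longrightarrow> s = [0] \<and> N = ideal_vecs I))" for n :: nat
  define Q where "Q n = (\<lambda>(s :: int list, N :: ('v, 'k) fvec set, hs, us :: int list) (s', N', hs' :: ('v, 'k) fvec list, us' :: int list).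
    s' = us \<and> N' = syz (hs :: ('v, 'k) fvec list))" for n :: nat
  have "\<exists>X. \<forall>n. P n (X n) \<and> Q n (X n) (X (Suc n))"
  proof (rule dependent_nat_choice)
    obtain hs us where "hom_gens [0] (ideal_vecs I) hs us" "minimal_gens hs"
      using reg_le_minimal_gens_exist[OF reg] by blast
    then have "P 0 ([0], ideal_vecs I, hs, us)"
      using reg by (auto simp: P_def)
    then show "\<exists>x. P 0 x" by (rule exI)
    fix x n assume Px: "P n x"
    obtain s N hs us where x: "x = (s, N, hs, us)" by (cases x) blast
    obtain \<rho> where "reg_le \<rho> s N" "hom_gens s N hs us" "minimal_gens hs"
      using Px unfolding P_def x by blast
    then have reg': "reg_le (\<rho> + 1) us (syz hs)"
      by (rule reg_le_minimal_gens(2))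
    then obtain hs' us' where "hom_gens us (syz hs) hs' us'" "minimal_gens hs'"
      using reg_le_minimal_gens_exist by blast
    then have "P (Suc n) (us, syz hs, hs', us') \<and> Q n x (us, syz hs, hs', us')"
      using reg' by (auto simp: P_def Q_def x)
    then show "\<exists>y. P (Suc n) y \<and> Q n x y" by (rule exI)
  qed
  then obtain X where X: "\<And>n. P n (X n)" "\<And>n. Q n (X n) (X (Suc n))" by blast
  define s where "s n = fst (X n)" for n
  define N where "N n = fst (snd (X n))" for n
  define hs where "hs n = fst (snd (snd (X n)))" for n
  have gens: "hom_gens (s n) (N n) (hs n) (s (Suc n))" and min: "minimal_gens (hs n)"
    and N: "N (Suc n) = syz (hs n)" for n
    using X(1)[of n] X(2)[of n] by (auto simp: P_def Q_def s_def N_def hs_def split: prod.splits)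
  have s0: "s 0 = [0]" and N0: "N 0 = ideal_vecs I"
    using X(1)[of 0] by (auto simp: P_def s_def N_def split: prod.splits)
  define D where "D n = mat (length (s n)) (length (s (Suc n))) (\<lambda>(a, b). (hs n ! b) a)" for n
  have len: "length (hs n) = length (s (Suc n))" for n
    using gens[of n] by (simp only: hom_gens_def)
  have hom: "hom_vec (s n) (s (Suc n) ! b) (hs n ! b)" if "b < length (s (Suc n))" for n b
    using gens[of n] that len by (simp add: hom_gens_def)
  have cols: "columns (D n) = hs n" for n
  proof (rule nth_equalityI)
    show "length (columns (D n)) = length (hs n)"
      by (simp add: D_def len)
    fix b assume "b < length (columns (D n))"
    then have b: "b < length (s (Suc n))" by (simp add: D_def)
    have "(columns (D n) ! b) a = (hs n ! b) a" for a
      using hom[OF b] b by (auto simp: columns_nth D_def hom_vec_def free_module_def)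
    then show "columns (D n) ! b = hs n ! b" by blast
  qed
  have dims: "dim_row (D n) = length (s n)" "dim_col (D n) = length (s (Suc n))" for n
    by (simp_all add: D_def)
  have image: "fvec_of ` (\<lambda>w. D n *\<^sub>v w) ` carrier_vec (length (s (Suc n))) = N n" for n
    using fvec_of_range[of "D n"] gens[of n] by (simp add: dims cols hom_gens_def)
  have range_carrier: "(\<lambda>w. D n *\<^sub>v w) ` A \<subseteq> carrier_vec (length (s n))" for n A
    using dims by (intro image_subsetI carrier_vecI) simp
  define F :: "(('v, 'k) mpoly, ('v, 'k) mpoly set) free_complex" where
    "F = \<lparr>shifts = s, diff = D, aug = [cls I 1]\<rparr>"
  have F: "shifts F = s" "diff F = D" "aug F = [cls I 1]"
    by (simp_all add: F_def)
  have rank: "free_rank F n = length (s n)" for n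
    by (simp add: free_rank_def F)
  have aug: "aug_map (quotient_module I) F v = cls I (v $ 0)" for v
    using aug_map_quotient[OF is_ideal, of F "\<lambda>_. 1" v] by (simp add: rank s0 F)
  have "minimal_graded_free_resolution (quotient_module I) F"
    unfolding minimal_graded_free_resolution_def graded_free_resolution_def
  proof (intro conjI allI)
    show "graded_free_data (quotient_module I) F"
      unfolding graded_free_data_def rank F
    proof (intro conjI allI impI)
      show "length [cls I 1] = length (s 0)" by (simp add: s0)
      show "[cls I 1] ! a \<in> component (quotient_module I) (s 0 ! a)" if "a < length (s 0)" for a
        using that by (simp add: s0 quotient_module_simps(5)[OF is_ideal])
      show "D n \<in> carrier_mat (length (s n)) (length (s (Suc n)))" for n
        by (simp add: D_def)
      show "D n $$ (a, b) \<in> homogeneous_part (s (Suc n) ! b - s n ! a)"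
        if "a < length (s n)" "b < length (s (Suc n))" for n a b
        using hom[OF that(2)] that by (simp add: D_def hom_vec_def)
    qed
    show "aug_map (quotient_module I) F ` carrier_vec (free_rank F 0) = carrier (quotient_module I)"
    proof
      show "aug_map (quotient_module I) F ` carrier_vec (free_rank F 0) \<subseteq> carrier (quotient_module I)"
        by (auto simp: aug quotient_module_simps(1)[OF is_ideal])
      show "carrier (quotient_module I) \<subseteq> aug_map (quotient_module I) F ` carrier_vec (free_rank F 0)"
      proof
        fix x assume "x \<in> carrier (quotient_module I)"
        then obtain f where "x = cls I f"
          unfolding quotient_module_simps(1)[OF is_ideal] by blast
        then have "x = aug_map (quotient_module I) F (vec 1 (\<lambda>_. f))"
          by (simp add: aug)
        moreover have "vec 1 (\<lambda>_. f) \<in> carrier_vec (free_rank F 0)"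
          unfolding rank s0 by (simp only: list.size add_0 One_nat_def vec_carrier)
        ultimately show "x \<in> aug_map (quotient_module I) F ` carrier_vec (free_rank F 0)"
          by (simp only: imageI)
      qed
    qed
    have "{v \<in> carrier_vec (free_rank F 0). aug_map (quotient_module I) F v = \<zero>\<^bsub>quotient_module I\<^esub>} =
        {v \<in> carrier_vec 1. v $ 0 \<in> I}"
      by (simp add: rank s0 aug quotient_module_simps(2)[OF is_ideal] cls_eq_zero_iff[OF is_ideal])
    also have "\<dots> = (\<lambda>w. D 0 *\<^sub>v w) ` carrier_vec (length (s (Suc 0)))"
    proof -
      have "fvec_of ` {v \<in> carrier_vec 1. v $ 0 \<in> I} =
          fvec_of ` (\<lambda>w. D 0 *\<^sub>v w) ` carrier_vec (length (s (Suc 0)))"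
        by (simp only: fvec_of_ideal image N0)
      moreover have "(\<lambda>w. D 0 *\<^sub>v w) ` A \<subseteq> carrier_vec 1" for A
        using range_carrier[of 0] by (simp add: s0)
      moreover have "{v \<in> carrier_vec 1. v $ 0 \<in> I} \<subseteq> carrier_vec 1"
        by blast
      ultimately show ?thesis
        by (simp only: inj_on_image_eq_iff[OF inj_on_fvec_of[of 1]])
    qed
    finally show "{v \<in> carrier_vec (free_rank F 0). aug_map (quotient_module I) F v = \<zero>\<^bsub>quotient_module I\<^esub>} =
       (\<lambda>w. diff F 0 *\<^sub>v w) ` carrier_vec (free_rank F 1)"
      by (simp add: rank F)
    show "mat_kernel (diff F n) =
       (\<lambda>w. diff F (Suc n) *\<^sub>v w) ` carrier_vec (free_rank F (Suc (Suc n)))" for n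
    proof -
      have "fvec_of ` mat_kernel (D n) =
          fvec_of ` (\<lambda>w. D (Suc n) *\<^sub>v w) ` carrier_vec (length (s (Suc (Suc n))))"
        by (simp only: fvec_of_kernel cols image N)
      moreover have "mat_kernel (D n) \<subseteq> carrier_vec (length (s (Suc n)))"
        by (auto simp: mat_kernel_def dims)
      ultimately show ?thesis
        unfolding rank F
        using inj_on_image_eq_iff[OF inj_on_fvec_of] range_carrier[of "Suc n"] by blast
    qed
    show "elements_mat (diff F n) \<subseteq> irrelevant_ideal" for n
    proof
      fix x assume "x \<in> elements_mat (diff F n)"
      then obtain a b where ab: "a < length (s n)" "b < length (s (Suc n))" "x = (hs n ! b) a"
        using elements_matD[of x "D n"] by (auto simp: F D_def)
      have mem: "hs n ! b \<in> N n"
        using hom_gens_mem[OF gens] ab(2) len by simp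
      have "const_coeff x = 0"
      proof (cases n)
        case 0
        then have "x \<in> I"
          using mem ab(1,3) N0 s0 by (simp add: ideal_vecs_def)
        then show ?thesis by (rule proper)
      next
        case (Suc m)
        then show ?thesis
          using minimal_gensD[OF min[of m], of "hs n ! b" a] mem N[of m] ab(3) by simp
      qed
      then show "x \<in> irrelevant_ideal"
        by (simp add: irrelevant_ideal_iff)
    qed
  qed
  then show ?thesis by blast
qed

theorem regularity_quotient_le:
  assumes reg: "reg_le (r + 1) [0] (ideal_vecs I)" and r: "0 \<le> r"
  shows "regularity (quotient_module I) \<le> r"
proof -
  define F where "F = (SOME F. minimal_graded_free_resolution (quotient_module I) F)"
  have F: "minimal_graded_free_resolution (quotient_module I) F"
    unfolding F_def by (rule someI_ex) (rule minimal_resolution_exists[OF reg])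
  let ?S = "{j - int i | i j. graded_betti (quotient_module I) i j \<noteq> 0}"
  have S: "?S = {j - int i | i j. j \<in> set (shifts F i)}"
    by (simp add: graded_betti_def F_def count_list_0_iff)
  have bounds: "?S \<subseteq> {0..r}"
    unfolding S using minimal_resolution_upper[OF F reg r] minimal_resolution_lower[OF F] by force
  have zero: "0 \<in> ?S"
  proof -
    have "0 \<in> set (shifts F 0)" "(0::int) = 0 - int 0"
      by (simp_all add: minimal_augmentation(1)[OF F])
    then show ?thesis unfolding S by blast
  qed
  show ?thesis
    unfolding regularity_def
  proof (rule Max.boundedI)
    show "finite ?S"
      by (rule finite_subset[OF bounds]) simp
    show "?S \<noteq> {}"
      using zero by (metis empty_iff)
    fix x assume "x \<in> ?S"
    then have "x \<in> {0..r}"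
      by (rule subsetD[OF bounds])
    then show "x \<le> r" by simp
  qed
qed

end

section \<open>Edge ideals of trees\<close>

theorem theorem3p2:
  fixes E :: "'v::finite set set" and n p :: nat and I :: "('v, 'k::field) mpoly set"
  assumes "is_tree E"
    and "n = CARD('v)" and "n \<ge> 2"
    and "p = num_pendant E"
    and "I = edge_ideal E"
  shows "regularity (quotient_module I) \<le>
           min (int n - int p) \<lfloor>(2 * real n - real p) / 3\<rfloor>"
proof -
  have two: "card e = 2" if "e \<in> E" for e
    using assms(1) that by (simp add: is_tree_def simple_graph_def)
  have I_eq: "I = sf_ideal E"
    unfolding assms(5) by (rule edge_ideal_eq[OF two])
  interpret proper_ideal I
  proof (rule proper_ideal.intro)
    show "ideal I class_ring"
      unfolding I_eq by (rule sf_ideal_is_ideal)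
    show "const_coeff f = 0" if f: "f \<in> I" for f
    proof (rule ccontr)
      assume "const_coeff f \<noteq> 0"
      then have "0 \<in> Poly_Mapping.keys f"
        by (simp add: in_keys_iff)
      then obtain e where "e \<in> E" "e \<subseteq> Poly_Mapping.keys (0 :: 'v \<Rightarrow>\<^sub>0 nat)"
        using f unfolding I_eq sf_ideal_def by blast
      then show False using two[of e] by simp
    qed
  qed
  define r where "r = min (int n - int p) \<lfloor>(2 * real n - real p) / 3\<rfloor>"
  have matching: "int (card M) \<le> r" if M: "M \<subseteq> E" "matching M" for M
  proof -
    have 1: "card M + p \<le> n"
      using matching_pendant_bound[OF assms(1) _ M] assms(2-4) by simp
    have 2: "2 * card M \<le> n"
      using card_mono[of UNIV "\<Union>M"] by (simp add: matching_card_Union[OF M(2)] assms(2))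
    have "3 * real (card M) \<le> 2 * real n - real p"
      using 1 2 by linarith
    then have "int (card M) \<le> \<lfloor>(2 * real n - real p) / 3\<rfloor>"
      by (simp add: le_floor_iff)
    with 1 show ?thesis by (simp add: r_def)
  qed
  have r: "0 \<le> r"
    using matching[of "{}"] by (simp add: matching_def)
  have "reg_upto k (int (nat r) + 1) [0] (ideal_vecs I)" for k
    unfolding I_eq
  proof (rule reg_le_matching_number)
    show "card e \<le> 2" if "e \<in> E" for e
      using two[OF that] by simp
    show "card M \<le> nat r" if "M \<subseteq> E" "matching M" for M
      using matching[OF that] by linarith
  qed
  then have "reg_le (r + 1) [0] (ideal_vecs I)"
    using r by (simp add: reg_le_def)
  then show ?thesis
    using regularity_quotient_le[OF _ r] by (simp add: r_def)
qed

end
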